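(* Fix $k$, and let $$\gamma_k(n) \;:=\; \sum_{\substack{u,v,w\in S_n\\ \mathrm{inv}(w)=k}} c^{w}_{u,v}.$$ Then $\gamma_k$ is a polynomial in $n$.
   Context: Here $k$ is a nonnegative integer, $n$ is a positive integer, and $S_n$ is the group of permutations of $[n]=\{1,\dots,n\}$. For $w\in S_n$, $\mathrm{inv}(w)$ is the number of pairs $i<j$ with $w(i)>w(j)$. Permutation multiplication on the right acts on positions; $s_i=(i,i+1)$ is an adjacent transposition; $i\in[n-1]$ is a descent of $w$ if $w(i)>w(i+1)$. Schubert polynomials are defined recursively: for the long permutation $\mathbf{w}_\circ=(n,n-1,\dots,1)\in S_n$, $\mathfrak{S}_{\mathbf{w}_\circ}=x_1^{n-1}x_2^{n-2}\cdots x_{n-1}$, and $\mathfrak{S}_{ws_i}=\partial_i\mathfrak{S}_w$ whenever $i$ is a descent of $w$, where $\partial_iF=(F-s_iF)/(x_i-x_{i+1})$ is the divided difference operator and $s_i$ acts on polynomials by swapping $x_i$ and $x_{i+1}$. They are compatible with the inclusions $S_n\subset S_{n+1}$ and so are indexed by $S_\infty=\bigcup_n S_n$. The Schubert coefficients $c^w_{u,v}$ are the structure constants defined by $\mathfrak{S}_u\cdot\mathfrak{S}_v=\sum_{w\in S_\infty}c^w_{u,v}\,\mathfrak{S}_w$ for $u,v\in S_n$.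
   Formalization: Polynomiality of γ_k(n) is asserted for n ≥ max(1,k), not for every positive n: for k=2 one has γ_2(n)=2(n²−4) for n ≥ 2, but γ_2(1)=0 rather than −6, so the claim fails literally for small n. *)

theory Defs
  imports
    "HOL-Library.Poly_Mapping"
    "HOL-Computational_Algebra.Polynomial"
    "HOL-Combinatorics.Permutations"
begin

text \<open>
  Polynomials over the integers in variables indexed by the natural numbers are elements of the
  monoid algebra \<open>(nat \<Rightarrow>\<^sub>0 nat) \<Rightarrow>\<^sub>0 int\<close>: finitely supported functions sending an exponent vector
  to its coefficient. Only the variables \<open>Var i\<close> with \<open>i \<ge> 1\<close> are used.
\<close>

type_synonym mpoly_int = "(nat \<Rightarrow>\<^sub>0 nat) \<Rightarrow>\<^sub>0 int"

definition Var :: "nat \<Rightarrow> mpoly_int" where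
  "Var i = Poly_Mapping.single (Poly_Mapping.single i 1) 1"

text \<open>
  \<open>map_key f p\<close> is precomposition of \<open>p\<close> with the injection \<open>f\<close>. The inner instance permutes the
  entries of an exponent vector, the outer one transports the coefficients; as the transposition
  is an involution, the result is \<open>F\<close> with \<open>Var i\<close> and \<open>Var (i + 1)\<close> exchanged.
\<close>

definition swap_vars :: "nat \<Rightarrow> mpoly_int \<Rightarrow> mpoly_int" where
  "swap_vars i F =
     Poly_Mapping.map_key (Poly_Mapping.map_key (transpose i (i + 1)) :: (nat \<Rightarrow>\<^sub>0 nat) \<Rightarrow> (nat \<Rightarrow>\<^sub>0 nat)) F"

definition divided_difference :: "nat \<Rightarrow> mpoly_int \<Rightarrow> mpoly_int" where
  "divided_difference i F = (THE G. (Var i - Var (i + 1)) * G = F - swap_vars i F)"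

definition S_infinity :: "(nat \<Rightarrow> nat) set" where
  "S_infinity = (\<Union>n. {w. w permutes {1..n}})"

definition inv_number :: "nat \<Rightarrow> (nat \<Rightarrow> nat) \<Rightarrow> nat" where
  "inv_number n w = card {(i, j). i \<in> {1..n} \<and> j \<in> {1..n} \<and> i < j \<and> w i > w j}"

definition long_perm :: "nat \<Rightarrow> nat \<Rightarrow> nat" where
  "long_perm n i = (if i \<in> {1..n} then n + 1 - i else i)"

text \<open>
  \<open>schubert_rel n w F\<close>: the recursion inside \<open>S\<^sub>n\<close>, started at the long permutation, assigns \<open>F\<close>
  to \<open>w\<close>. The value is independent of the chain of descents and, by compatibility with the
  inclusions of \<open>S\<^sub>n\<close> in \<open>S\<^sub>n\<^sub>+\<^sub>1\<close>, of \<open>n\<close>; this is what makes the description in \<open>schubert\<close> proper.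
\<close>

inductive schubert_rel :: "nat \<Rightarrow> (nat \<Rightarrow> nat) \<Rightarrow> mpoly_int \<Rightarrow> bool" for n where
  long: "schubert_rel n (long_perm n) (\<Prod>i\<in>{1..n}. Var i ^ (n - i))"
| descent: "schubert_rel n w F \<Longrightarrow> 1 \<le> i \<Longrightarrow> i < n \<Longrightarrow> w i > w (i + 1)
    \<Longrightarrow> schubert_rel n (w \<circ> transpose i (i + 1)) (divided_difference i F)"

definition schubert :: "(nat \<Rightarrow> nat) \<Rightarrow> mpoly_int" where
  "schubert w = (THE F. \<exists>n. schubert_rel n w F)"

text \<open>
  The expansion coefficients of a product are themselves a finitely supported function, since
  only finitely many Schubert polynomials occur.
\<close>

definition schubert_coeff :: "(nat \<Rightarrow> nat) \<Rightarrow> (nat \<Rightarrow> nat) \<Rightarrow> (nat \<Rightarrow> nat) \<Rightarrow> int" where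
  "schubert_coeff u v w = Poly_Mapping.lookup
     (THE c :: (nat \<Rightarrow> nat) \<Rightarrow>\<^sub>0 int. Poly_Mapping.keys c \<subseteq> S_infinity \<and>
        schubert u * schubert v =
          (\<Sum>z\<in>Poly_Mapping.keys c. of_int (Poly_Mapping.lookup c z) * schubert z)) w"

text \<open>
  As for the number of permutations in \<open>S\<^sub>n\<close> with \<open>k\<close> inversions, polynomial behaviour in \<open>n\<close> starts at
  \<open>n = k\<close>: for \<open>k = 2\<close> the polynomial is \<open>2 (n\<^sup>2 - 4)\<close>, while the sum for \<open>n = 1\<close> is empty.
\<close>

definition schubert_coeff_sum :: "nat \<Rightarrow> nat \<Rightarrow> int" where
  "schubert_coeff_sum k n =
     (\<Sum>(u, v, w) \<in> {(u, v, w). u permutes {1..n} \<and> v permutes {1..n} \<and> w permutes {1..n} \<and>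
        inv_number n w = k}. schubert_coeff u v w)"

end

theory Submission
  imports Defs
begin

text \<open>
  The permutations \<open>w\<close> are grouped by their support, the set of those \<open>m\<close> for which \<open>w\<close> does not map
  \<open>{1..m}\<close> to itself, that is, for which \<open>s\<^sub>m\<close> occurs in the reduced words of \<open>w\<close>. A permutation with \<open>k\<close>
  inversions has a support of at most \<open>k\<close> elements, and \<open>w\<close> is in \<open>S\<^sub>n\<close> exactly if its support is contained
  in \<open>{1..<n}\<close>. So the sum in question is the sum of \<open>support_sum k J\<close> over the sets \<open>J \<subseteq> {1..<n}\<close> with at
  most \<open>k\<close> elements, where \<open>support_sum k J\<close> adds up the coefficients with \<open>w\<close> of support \<open>J\<close>
  (\<open>schubert_coeff_sum_by_support\<close>).

  The value \<open>support_sum k J\<close> depends on the lengths of the runs of consecutive elements of \<open>J\<close>, in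
  their order, but not on the gaps between them (\<open>support_sum_shift\<close>). There are \<open>n - r choose j\<close> sets
  \<open>J \<subseteq> {1..<n}\<close> with \<open>r\<close> elements and a prescribed sequence of \<open>j\<close> run lengths. This is a polynomial in
  \<open>n\<close> as long as \<open>n \<ge> r\<close>, and \<open>r \<le> k\<close>. The count is carried out as a recursion that splits off the
  first run (\<open>subset_sum_binomial_combination\<close>).

  That the gaps do not matter is proved through the functionals dual to Schubert polynomials. The
  coefficient \<open>c\<^sup>w\<close> of a product is the constant term of \<open>\<partial>\<^sub>w\<close> applied to the product
  (\<open>schubert_coeff_eq_dual\<close>); the operators \<open>\<partial>\<^sub>w\<close> and the Schubert polynomials themselves are well defined
  by one and the same diamond argument (\<open>ascent_chain_unique\<close>). By the Leibniz rule, the polynomials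
  annihilated by all functionals of a parabolic subgroup form an ideal (\<open>dual_kernel_mult\<close>). Therefore
  a nonzero coefficient forces \<open>u\<close> and \<open>v\<close> into the parabolic subgroup of the support of \<open>w\<close>, and
  products may be computed modulo this ideal. If \<open>m\<close> is outside the support, then setting
  \<open>x\<^sub>m\<^sub>+\<^sub>1 = 0\<close> and renumbering the later variables intertwines the divided differences that matter, and
  modulo the ideal it takes the Schubert polynomial of a permutation with a new fixed point \<open>m + 1\<close> to
  that of the original one. Hence the coefficients do not change when a fixed point is inserted
  (\<open>schubert_coeff_insert_fixed_point\<close>), and this operation moves the elements of the support above
  \<open>m\<close> up by one.
\<close>

section \<open>Evaluation of polynomials\<close>

lemma poly_mapping_additive_induct [case_names zero single add]:
  fixes p :: "'a \<Rightarrow>\<^sub>0 'b::comm_monoid_add"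
  assumes "P 0" "\<And>k c. P (Poly_Mapping.single k c)" "\<And>p q. P p \<Longrightarrow> P q \<Longrightarrow> P (p + q)"
  shows "P p"
proof -
  have sum_monomials: "p = (\<Sum>k\<in>Poly_Mapping.keys p. Poly_Mapping.single k (Poly_Mapping.lookup p k))"
    by (rule poly_mapping_eqI) (auto simp: lookup_sum lookup_single when_def in_keys_iff)
  have "P (\<Sum>k\<in>A. Poly_Mapping.single k (Poly_Mapping.lookup p k))" if "finite A" for A
    using that by (induction A) (auto intro: assms)
  then show ?thesis
    by (subst sum_monomials) simp
qed

definition monomial_eval :: "(nat \<Rightarrow> 'a::comm_ring_1) \<Rightarrow> (nat \<Rightarrow>\<^sub>0 nat) \<Rightarrow> 'a" where
  "monomial_eval x e = (\<Prod>i\<in>Poly_Mapping.keys e. x i ^ Poly_Mapping.lookup e i)"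

text \<open>
  Substitution is a ring homomorphism, and every operation on polynomials below is an instance:
  exchanging variables, discarding variables, rescaling all variables, taking the constant term.
  Identities between compositions of such operations need to be compared only on the variables.
\<close>

definition mpoly_eval :: "(nat \<Rightarrow> 'a::comm_ring_1) \<Rightarrow> mpoly_int \<Rightarrow> 'a" where
  "mpoly_eval x F =
     (\<Sum>e\<in>Poly_Mapping.keys F. of_int (Poly_Mapping.lookup F e) * monomial_eval x e)"

lemma of_int_eq_single: "(of_int c :: mpoly_int) = Poly_Mapping.single 0 c"
  by (metis id_apply of_int_eq_id single_of_int)

lemma monomial_eval_superset:
  assumes "finite A" "Poly_Mapping.keys e \<subseteq> A"
  shows "monomial_eval x e = (\<Prod>i\<in>A. x i ^ Poly_Mapping.lookup e i)"
  unfolding monomial_eval_def using assms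
  by (intro prod.mono_neutral_left) (auto simp: in_keys_iff)

lemma monomial_eval_0 [simp]: "monomial_eval x 0 = 1"
  by (simp add: monomial_eval_def)

lemma monomial_eval_single [simp]: "monomial_eval x (Poly_Mapping.single i n) = x i ^ n"
  by (simp add: monomial_eval_def)

lemma monomial_eval_add: "monomial_eval x (e + e') = monomial_eval x e * monomial_eval x e'"
proof -
  let ?A = "Poly_Mapping.keys e \<union> Poly_Mapping.keys e'"
  have "Poly_Mapping.keys (e + e') \<subseteq> ?A" by (rule keys_add)
  then show ?thesis
    by (simp add: monomial_eval_superset[of ?A] lookup_add power_add prod.distrib)
qed

lemma mpoly_eval_0 [simp]: "mpoly_eval x 0 = 0"
  by (simp add: mpoly_eval_def)

lemma mpoly_eval_single:
  "mpoly_eval x (Poly_Mapping.single e c) = of_int c * monomial_eval x e"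
  by (simp add: mpoly_eval_def)

lemma mpoly_eval_add [simp]: "mpoly_eval x (F + G) = mpoly_eval x F + mpoly_eval x G"
  unfolding mpoly_eval_def
  by (rule setsum_keys_plus_distrib) (auto simp: algebra_simps)

lemma mpoly_eval_mult [simp]: "mpoly_eval x (F * G) = mpoly_eval x F * mpoly_eval x G"
proof (induction F rule: poly_mapping_additive_induct)
  case (single e c)
  show ?case
    by (induction G rule: poly_mapping_additive_induct)
       (auto simp: mult_single mpoly_eval_single monomial_eval_add algebra_simps)
qed (auto simp: algebra_simps)

lemma mpoly_eval_Var [simp]: "mpoly_eval x (Var i) = x i"
  by (simp add: Var_def mpoly_eval_single)

lemma mpoly_eval_of_int [simp]: "mpoly_eval x (of_int c) = of_int c"
  by (simp add: of_int_eq_single mpoly_eval_single)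

lemma mpoly_eval_1 [simp]: "mpoly_eval x 1 = 1"
  using mpoly_eval_of_int[of x 1] by simp

lemma mpoly_eval_uminus [simp]: "mpoly_eval x (- F) = - mpoly_eval x F"
  using mpoly_eval_add[of x F "- F"] by (simp add: minus_unique)

lemma mpoly_eval_diff [simp]: "mpoly_eval x (F - G) = mpoly_eval x F - mpoly_eval x G"
  using mpoly_eval_add[of x F "- G"] by simp

lemma mpoly_eval_power [simp]: "mpoly_eval x (F ^ n) = mpoly_eval x F ^ n"
  by (induction n) auto

lemma mpoly_eval_prod: "mpoly_eval x (\<Prod>i\<in>A. f i) = (\<Prod>i\<in>A. mpoly_eval x (f i))"
  by (induction A rule: infinite_finite_induct) auto

lemma mpoly_int_induct [case_names const var add mult]:
  fixes F :: mpoly_int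
  assumes "\<And>c. P (of_int c)" "\<And>i. P (Var i)"
    and "\<And>F G. P F \<Longrightarrow> P G \<Longrightarrow> P (F + G)" "\<And>F G. P F \<Longrightarrow> P G \<Longrightarrow> P (F * G)"
  shows "P F"
proof (induction F rule: poly_mapping_additive_induct)
  case zero
  show ?case using assms(1)[of 0] by simp
next
  case (single e c)
  have one: "P 1" using assms(1)[of 1] by simp
  have pow: "P (Poly_Mapping.single (Poly_Mapping.single i n) 1)" for i n
  proof (induction n)
    case 0
    show ?case using one by simp
  next
    case (Suc n)
    have "Poly_Mapping.single (Poly_Mapping.single i (Suc n)) 1
        = Var i * Poly_Mapping.single (Poly_Mapping.single i n) 1"
      by (simp add: Var_def mult_single flip: single_add)
    then show ?case using assms(4)[OF assms(2)[of i] Suc] by simp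
  qed
  have "P (Poly_Mapping.single e 1)"
  proof (induction e rule: poly_mapping_additive_induct)
    case zero
    show ?case using one by simp
  next
    case (single i n)
    show ?case by (rule pow)
  next
    case (add e e')
    then show ?case using assms(4)[OF add] by (simp add: mult_single)
  qed
  moreover have "Poly_Mapping.single e c = of_int c * Poly_Mapping.single e 1"
    by (simp add: of_int_eq_single mult_single)
  ultimately show ?case using assms(1,4) by metis
next
  case (add F G)
  then show ?case by (rule assms)
qed

lemma mpoly_eval_eval: "mpoly_eval x (mpoly_eval y F) = mpoly_eval (\<lambda>i. mpoly_eval x (y i)) F"
  by (induction F rule: mpoly_int_induct) auto

lemma mpoly_eval_Var_id [simp]: "mpoly_eval Var F = F"
  by (induction F rule: mpoly_int_induct) auto

lemma mpoly_eval_zero_const: "mpoly_eval (\<lambda>_. 0) F = of_int (mpoly_eval (\<lambda>_. 0) F)"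
  by (induction F rule: mpoly_int_induct) auto

section \<open>Divided differences\<close>

text \<open>
  Both sides are additive in \<open>F\<close>, and permuting the exponent vector of a monomial has the same
  effect as permuting its variables.
\<close>

lemma swap_vars_eval: "swap_vars i F = mpoly_eval (\<lambda>j. Var (transpose i (i + 1) j)) F"
proof -
  let ?t = "transpose i (i + 1)"
  let ?m = "Poly_Mapping.map_key ?t :: (nat \<Rightarrow>\<^sub>0 nat) \<Rightarrow> (nat \<Rightarrow>\<^sub>0 nat)"
  have inj: "inj ?t" by simp
  have invol: "?m (?m e) = e" for e
    using map_key_compose[OF inj inj, of e] map_key_id[of e] by (simp add: comp_def)
  have inj_m: "inj ?m" by (metis injI invol)
  have monom: "monomial_eval (\<lambda>j. Var (?t j)) e = Poly_Mapping.single (?m e) 1" for e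
  proof (induction e rule: poly_mapping_additive_induct)
    case zero
    show ?case by (simp add: map_key_zero[OF inj])
  next
    case (single j n)
    have "Var (?t j) ^ n = Poly_Mapping.single (Poly_Mapping.single (?t j) n) 1"
      by (induction n) (auto simp: Var_def mult_single simp flip: single_add)
    also have "Poly_Mapping.single (?t j) n = ?m (Poly_Mapping.single j n)"
      using map_key_single[OF inj, of "?t j" n] by simp
    finally show ?case by simp
  next
    case (add e e')
    have "?m (e + e') = ?m e + ?m e'" by (rule map_key_plus[OF inj])
    with add show ?case by (simp only: monomial_eval_add mult_single mult_1)
  qed
  show ?thesis unfolding swap_vars_def
  proof (induction F rule: poly_mapping_additive_induct)
    case zero
    show ?case by (simp only: map_key_zero[OF inj_m] mpoly_eval_0)
  next
    case (single e c)
    have "Poly_Mapping.map_key ?m (Poly_Mapping.single e c) = Poly_Mapping.single (?m e) c"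
      using map_key_single[OF inj_m, of "?m e" c] by (simp only: invol)
    also have "\<dots> = of_int c * Poly_Mapping.single (?m e) 1"
      by (simp add: of_int_eq_single mult_single)
    finally show ?case by (simp only: mpoly_eval_single monom)
  next
    case (add F G)
    then show ?case by (simp only: map_key_plus[OF inj_m] mpoly_eval_add)
  qed
qed

lemma Var_eq_iff [simp]: "Var i = Var j \<longleftrightarrow> i = j"
proof -
  have "Var i = Var j \<Longrightarrow> Poly_Mapping.keys (Var i) = Poly_Mapping.keys (Var j)" by simp
  then have "Var i = Var j \<Longrightarrow> Poly_Mapping.single i 1 = Poly_Mapping.single j (1::nat)"
    unfolding Var_def keys_frag_of by simp
  then show ?thesis by (metis lookup_single_eq lookup_single_not_eq zero_neq_one)
qed

lemma Var_neq_0 [simp]: "Var i \<noteq> 0"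
  by (simp add: Var_def flip: single_zero)

lemma divided_difference_unique:
  "(Var i - Var (i + 1)) * G = F - swap_vars i F \<Longrightarrow> divided_difference i F = G"
  unfolding divided_difference_def
  by (rule the_equality) (auto simp: mult_cancel_left dest: sym)

text \<open>
  The polynomials with this property contain the constants and the variables, and they are closed
  under products because \<open>F G - s(F) s(G) = (F - s(F)) G + s(F) (G - s(G))\<close>.
\<close>

lemma divided_difference_dvd: "Var i - Var (i + 1) dvd F - swap_vars i F"
proof (induction F rule: mpoly_int_induct)
  case (var j)
  have "Var i - Var (i + 1) dvd Var (i + 1) - Var i"
    by (metis dvd_minus_iff dvd_refl minus_diff_eq)
  then show ?case by (auto simp: swap_vars_eval transpose_def)
next
  case (add F G)
  have "F + G - swap_vars i (F + G) = (F - swap_vars i F) + (G - swap_vars i G)"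
    by (simp add: swap_vars_eval algebra_simps)
  then show ?case using add by (metis dvd_add)
next
  case (mult F G)
  have "F * G - swap_vars i (F * G) = (F - swap_vars i F) * G + swap_vars i F * (G - swap_vars i G)"
    by (simp add: swap_vars_eval algebra_simps)
  then show ?case using mult by (metis dvd_add dvd_mult dvd_mult2)
qed (simp add: swap_vars_eval)

lemma divided_difference_mult:
  "(Var i - Var (i + 1)) * divided_difference i F = F - swap_vars i F"
  using divided_difference_dvd[of i F] divided_difference_unique[of i _ F] by (metis dvdE)

lemma swap_vars_involution [simp]: "swap_vars i (swap_vars i F) = F"
  by (simp add: swap_vars_eval mpoly_eval_eval)

lemma divided_difference_add:
  "divided_difference i (F + G) = divided_difference i F + divided_difference i G"
  by (rule divided_difference_unique)
     (simp only: distrib_left divided_difference_mult, simp add: swap_vars_eval)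

lemma divided_difference_const_mult:
  "divided_difference i (of_int c * F) = of_int c * divided_difference i F"
proof (rule divided_difference_unique)
  have "(Var i - Var (i + 1)) * (of_int c * divided_difference i F)
      = of_int c * ((Var i - Var (i + 1)) * divided_difference i F)"
    by (rule mult.left_commute)
  then show "(Var i - Var (i + 1)) * (of_int c * divided_difference i F)
      = of_int c * F - swap_vars i (of_int c * F)"
    unfolding divided_difference_mult by (simp add: swap_vars_eval right_diff_distrib)
qed

lemma divided_difference_const [simp]: "divided_difference i (of_int c) = 0"
  by (rule divided_difference_unique) (simp add: swap_vars_eval)

lemma divided_difference_0 [simp]: "divided_difference i 0 = 0"
  using divided_difference_const[of i 0] by simp

lemma divided_difference_diff:
  "divided_difference i (F - G) = divided_difference i F - divided_difference i G"
  using divided_difference_add[of i F "of_int (-1) * G"]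
    divided_difference_const_mult[of i "-1" G] by simp

lemma divided_difference_sum:
  "divided_difference i (\<Sum>a\<in>A. f a) = (\<Sum>a\<in>A. divided_difference i (f a))"
  by (induction A rule: infinite_finite_induct) (auto simp: divided_difference_add)

lemma swap_vars_conv_divided_difference:
  "swap_vars i F = F - (Var i - Var (i + 1)) * divided_difference i F"
  by (simp only: divided_difference_mult) simp

lemma divided_difference_Leibniz:
  "divided_difference i (F * G) =
     divided_difference i F * G + swap_vars i F * divided_difference i G"
proof (rule divided_difference_unique)
  have "(Var i - Var (i + 1)) * (divided_difference i F * G + swap_vars i F * divided_difference i G)
      = ((Var i - Var (i + 1)) * divided_difference i F) * G
        + swap_vars i F * ((Var i - Var (i + 1)) * divided_difference i G)"
    by (simp only: distrib_left mult_ac)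
  then show "(Var i - Var (i + 1)) * (divided_difference i F * G + swap_vars i F * divided_difference i G)
      = F * G - swap_vars i (F * G)"
    unfolding divided_difference_mult by (simp add: swap_vars_eval algebra_simps)
qed

lemma divided_difference_invariant_mult:
  "swap_vars i F = F \<Longrightarrow> divided_difference i (F * G) = F * divided_difference i G"
  using divided_difference_mult[of i F] by (simp add: divided_difference_Leibniz)

lemma swap_vars_divided_difference [simp]:
  "swap_vars i (divided_difference i F) = divided_difference i F"
proof -
  have "(Var (i + 1) - Var i) * swap_vars i (divided_difference i F) = swap_vars i F - F"
    using arg_cong[OF divided_difference_mult[of i F], of "swap_vars i"]
    by (simp add: swap_vars_eval) (simp add: mpoly_eval_eval)
  then have "(Var i - Var (i + 1)) * swap_vars i (divided_difference i F) = F - swap_vars i F"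
    by (simp add: algebra_simps)
  then show ?thesis by (metis divided_difference_unique)
qed

lemma divided_difference_square [simp]: "divided_difference i (divided_difference i F) = 0"
  by (rule divided_difference_unique) simp

text \<open>
  A substitution that carries the swap at \<open>j\<close> to the swap at \<open>i\<close> intertwines the two
  divided differences, because it carries the defining equation of one to that of the other.
  The factor \<open>c\<close> is \<open>Var 0\<close> for the rescaling of all variables and \<open>1\<close> for the substitutions
  that discard or renumber variables.
\<close>

lemma mpoly_eval_divided_difference:
  assumes "\<And>l. x (transpose j (j + 1) l) = swap_vars i (x l)"
    and "x j - x (j + 1) = c * (Var i - Var (i + 1))"
  shows "c * mpoly_eval x (divided_difference j F) = divided_difference i (mpoly_eval x F)"
proof -
  have "(x j - x (j + 1)) * mpoly_eval x (divided_difference j F)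
      = mpoly_eval x F - mpoly_eval x (swap_vars j F)"
    using arg_cong[OF divided_difference_mult[of j F], of "mpoly_eval x"] by simp
  also have "mpoly_eval x (swap_vars j F) = swap_vars i (mpoly_eval x F)"
    using assms(1) by (simp add: swap_vars_eval mpoly_eval_eval)
  finally show ?thesis
    by (intro divided_difference_unique[symmetric]) (simp only: assms(2) mult_ac)
qed

section \<open>Adjacent transpositions and inversions\<close>

abbreviation adj :: "nat \<Rightarrow> nat \<Rightarrow> nat" where
  "adj i \<equiv> transpose i (i + 1)"

definition inversions :: "(nat \<Rightarrow> nat) \<Rightarrow> (nat \<times> nat) set" where
  "inversions w = {(i, j). i < j \<and> w j < w i}"

lemma S_infinity_iff: "w \<in> S_infinity \<longleftrightarrow> (\<exists>n. w permutes {1..n})"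
  by (auto simp: S_infinity_def)

lemma id_in_S_infinity [simp]: "id \<in> S_infinity"
  by (auto simp: S_infinity_iff permutes_id)

lemma S_infinity_fixes_0: "w \<in> S_infinity \<Longrightarrow> w 0 = 0"
  by (auto simp: S_infinity_iff permutes_def)

lemma S_infinity_bij: "w \<in> S_infinity \<Longrightarrow> bij w"
  by (auto simp: S_infinity_iff permutes_bij)

lemma S_infinity_eq_iff: "w \<in> S_infinity \<Longrightarrow> w i = w j \<longleftrightarrow> i = j"
  by (meson S_infinity_bij bij_is_inj inj_eq)

lemma permutes_adj:
  "w permutes {1..n} \<Longrightarrow> 1 \<le> i \<Longrightarrow> i < n \<Longrightarrow> w \<circ> adj i permutes {1..n}"
  by (intro permutes_compose permutes_swap_id) auto

lemma S_infinity_adj: "w \<in> S_infinity \<Longrightarrow> 1 \<le> i \<Longrightarrow> w \<circ> adj i \<in> S_infinity"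
proof -
  assume "w \<in> S_infinity" "1 \<le> i"
  then obtain n where "w permutes {1..n}" by (auto simp: S_infinity_iff)
  then have "w permutes {1..max n (i + 1)}" by (rule permutes_subset) auto
  then have "w \<circ> adj i permutes {1..max n (i + 1)}"
    using \<open>1 \<le> i\<close> by (intro permutes_adj) auto
  then show ?thesis by (auto simp: S_infinity_iff)
qed

lemma comp_transpose_twice [simp]: "w \<circ> transpose i j \<circ> transpose i j = w"
  by (simp add: comp_assoc)

lemma inversions_subset:
  assumes "w permutes {1..n}"
  shows "inversions w \<subseteq> {1..n} \<times> {1..n}"
proof -
  have "i \<in> {1..n} \<and> j \<in> {1..n}" if "i < j" "w j < w i" for i j
  proof -
    have out: "w x = x" if "x \<notin> {1..n}" for x using assms that by (simp add: permutes_def)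
    have "w i \<in> {1..n} \<longleftrightarrow> i \<in> {1..n}" "w j \<in> {1..n} \<longleftrightarrow> j \<in> {1..n}"
      using permutes_in_image[OF assms] by blast+
    then show ?thesis using that out[of i] out[of j] by (cases "i \<in> {1..n}"; cases "j \<in> {1..n}") auto
  qed
  then show ?thesis by (auto simp: inversions_def)
qed

lemma finite_inversions: "w \<in> S_infinity \<Longrightarrow> finite (inversions w)"
  by (metis S_infinity_iff finite_SigmaI finite_atLeastAtMost finite_subset inversions_subset)

lemma inv_number_eq: "w permutes {1..n} \<Longrightarrow> inv_number n w = card (inversions w)"
  unfolding inv_number_def using inversions_subset[of w n]
  by (intro arg_cong[where f = card]) (auto simp: inversions_def)

lemma inversions_id [simp]: "inversions id = {}"
  by (auto simp: inversions_def)

lemma adj_less_iff: "(a, b) \<noteq> (i, i + 1) \<Longrightarrow> a < b \<Longrightarrow> adj i a < adj i b"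
  by (auto simp: transpose_def)

text \<open>
  Exchanging the entries at two adjacent positions changes the relative order of this pair only.
\<close>

lemma inversions_ascent:
  assumes "w i < w (i + 1)"
  shows "inversions (w \<circ> adj i) = insert (i, i + 1) (map_prod (adj i) (adj i) ` inversions w)"
proof (rule set_eqI, clarify, rule iffI)
  fix a b assume ab: "(a, b) \<in> inversions (w \<circ> adj i)"
  show "(a, b) \<in> insert (i, i + 1) (map_prod (adj i) (adj i) ` inversions w)"
  proof (cases "(a, b) = (i, i + 1)")
    case False
    with ab have "(adj i a, adj i b) \<in> inversions w"
      using adj_less_iff[of a b i] by (auto simp: inversions_def)
    then have "map_prod (adj i) (adj i) (adj i a, adj i b) \<in> map_prod (adj i) (adj i) ` inversions w"
      by (rule imageI)
    then show ?thesis by simp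
  qed simp
next
  fix a b assume "(a, b) \<in> insert (i, i + 1) (map_prod (adj i) (adj i) ` inversions w)"
  then consider "a = i" "b = i + 1"
    | c d where "(c, d) \<in> inversions w" "a = adj i c" "b = adj i d" by auto
  then show "(a, b) \<in> inversions (w \<circ> adj i)"
  proof cases
    case 1
    then show ?thesis using assms by (auto simp: inversions_def)
  next
    case 2
    then have "(c, d) \<noteq> (i, i + 1)" using assms by (auto simp: inversions_def)
    then show ?thesis using 2 adj_less_iff[of c d i] by (auto simp: inversions_def)
  qed
qed

lemma card_inversions_ascent:
  assumes "w \<in> S_infinity" "w i < w (i + 1)"
  shows "card (inversions (w \<circ> adj i)) = Suc (card (inversions w))"
proof -
  have "inj (map_prod (adj i) (adj i))"
    using prod.inj_map[of "adj i" "adj i"] by simp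
  moreover have "(i, i + 1) \<notin> map_prod (adj i) (adj i) ` inversions w"
    by (auto simp: inversions_def transpose_def split: if_splits)
  moreover have "finite (map_prod (adj i) (adj i) ` inversions w)"
    by (intro finite_imageI finite_inversions assms)
  moreover have "card (map_prod (adj i) (adj i) ` inversions w) = card (inversions w)"
    using calculation(1) by (intro card_image) (blast intro: inj_on_subset)
  ultimately show ?thesis
    unfolding inversions_ascent[OF assms(2)] by (simp only: card_insert_disjoint not_False_eq_True)
qed

lemma card_inversions_descent:
  assumes "w \<in> S_infinity" "1 \<le> i" "w (i + 1) < w i"
  shows "card (inversions w) = Suc (card (inversions (w \<circ> adj i)))"
proof -
  have "card (inversions (w \<circ> adj i \<circ> adj i)) = Suc (card (inversions (w \<circ> adj i)))"
    using assms by (intro card_inversions_ascent S_infinity_adj) auto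
  then show ?thesis by (simp only: comp_transpose_twice)
qed

lemma no_descent_imp_id:
  assumes "w \<in> S_infinity" "\<And>i. 1 \<le> i \<Longrightarrow> w i \<le> w (i + 1)"
  shows "w = id"
proof -
  have "w i < w (Suc i)" for i
  proof (cases i)
    case 0
    then show ?thesis
      using S_infinity_eq_iff[OF assms(1), of "Suc i" 0] S_infinity_fixes_0[OF assms(1)] by simp
  next
    case (Suc j)
    then show ?thesis
      using S_infinity_eq_iff[OF assms(1), of i "Suc i"] assms(2)[of i] by simp
  qed
  then have mono: "strict_mono w" by (simp add: strict_mono_Suc_iff)
  have "w i = i" for i
  proof (induction i rule: less_induct)
    case (less i)
    obtain j where j: "w j = i" using S_infinity_bij[OF assms(1)] by (metis bij_pointE)
    have "\<not> j < i" using less[of j] j by (metis less_irrefl)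
    moreover have "\<not> i < j"
      using j strict_mono_imp_increasing[OF mono, of i] strict_monoD[OF mono, of i j] by linarith
    ultimately have "j = i" by simp
    then show ?case using j by simp
  qed
  then show ?thesis by (simp add: fun_eq_iff)
qed

lemma S_infinity_descent:
  assumes "w \<in> S_infinity" "w \<noteq> id"
  obtains i where "1 \<le> i" "w (i + 1) < w i"
  using no_descent_imp_id[OF assms(1)] assms(2) by (metis not_le)

lemma S_infinity_induct [consumes 1, case_names id ascent]:
  assumes "w \<in> S_infinity" "P id"
    and ascent: "\<And>w i. w \<in> S_infinity \<Longrightarrow> 1 \<le> i \<Longrightarrow> w i < w (i + 1) \<Longrightarrow> P w \<Longrightarrow> P (w \<circ> adj i)"
  shows "P w"
  using assms(1)
proof (induction "card (inversions w)" arbitrary: w rule: less_induct)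
  case less
  show ?case
  proof (cases "w = id")
    case False
    then obtain i where i: "1 \<le> i" "w (i + 1) < w i"
      using S_infinity_descent less.prems by blast
    let ?v = "w \<circ> adj i"
    have v: "?v \<in> S_infinity" using S_infinity_adj less.prems i by blast
    have "card (inversions ?v) < card (inversions w)"
      using card_inversions_descent[OF less.prems i] by simp
    then have "P ?v" using less.hyps v by blast
    moreover have "?v i < ?v (i + 1)" using i by simp
    ultimately have "P (?v \<circ> adj i)" using v i(1) ascent by blast
    then show ?thesis by (simp only: comp_transpose_twice)
  qed (simp only: assms(2))
qed

section \<open>Independence of the chain of ascents\<close>

text \<open>
  Multiplying by \<open>s\<^sub>i\<close> at an ascent of \<open>w\<close> is accompanied by an operator \<open>d i\<close>. Two recursions have
  this form: the one for the functionals \<open>F \<mapsto> constant term of \<partial>\<^sub>w F\<close>, and the descending recursion for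
  Schubert polynomials, once each permutation is multiplied by the long one on the left.
\<close>

inductive ascent_chain :: "(nat \<Rightarrow> 'a \<Rightarrow> 'a) \<Rightarrow> 'a \<Rightarrow> (nat \<Rightarrow> nat) \<Rightarrow> 'a \<Rightarrow> bool"
  for d x where
  base: "ascent_chain d x id x"
| step: "ascent_chain d x w y \<Longrightarrow> 1 \<le> i \<Longrightarrow> w i < w (i + 1)
    \<Longrightarrow> ascent_chain d x (w \<circ> adj i) (d i y)"

lemma ascent_chain_S_infinity: "ascent_chain d x w y \<Longrightarrow> w \<in> S_infinity"
  by (induction rule: ascent_chain.induct) (blast intro: S_infinity_adj id_in_S_infinity)+

lemma ascent_chain_exists: "w \<in> S_infinity \<Longrightarrow> \<exists>y. ascent_chain d x w y"
  by (induction rule: S_infinity_induct) (blast intro: ascent_chain.intros)+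

lemma ascent_chain_step':
  "ascent_chain d x w y \<Longrightarrow> 1 \<le> i \<Longrightarrow> w i < w (i + 1) \<Longrightarrow> v = w \<circ> adj i
    \<Longrightarrow> ascent_chain d x v (d i y)"
  by (simp only: ascent_chain.step)

lemma ascent_chain_cases:
  assumes "ascent_chain d x w y"
  obtains "w = id" "y = x"
  | i z where "1 \<le> i" "w (i + 1) < w i" "ascent_chain d x (w \<circ> adj i) z" "y = d i z"
  using assms
proof (cases rule: ascent_chain.cases)
  case (step v z i)
  then have "w (i + 1) < w i" "w \<circ> adj i = v" by auto
  then show ?thesis using step that(2)[of i z] by blast
qed

locale braid_operators =
  fixes d :: "nat \<Rightarrow> 'a \<Rightarrow> 'a"
  assumes far_commute: "i + 1 < j \<Longrightarrow> d i (d j y) = d j (d i y)"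
    and braid: "d i (d (i + 1) (d i y)) = d (i + 1) (d i (d (i + 1) y))"
begin

text \<open>
  This is the induction step for the independence of the chain. Chains whose last factors are
  \<open>s\<^sub>i\<close> and \<open>s\<^sub>j\<close> are compared with chains through the shortest element of the coset of \<open>w\<close> under the
  group generated by \<open>s\<^sub>i\<close> and \<open>s\<^sub>j\<close>; between that element and \<open>w\<close> the two routes differ by one
  commutation or one braid relation.
\<close>

lemma ascent_chain_diamond:
  assumes IH: "\<And>v y y'. card (inversions v) < card (inversions w) \<Longrightarrow>
                 ascent_chain d x v y \<Longrightarrow> ascent_chain d x v y' \<Longrightarrow> y = y'"
    and w: "w \<in> S_infinity" and ij: "1 \<le> i" "i < j"
    and desc: "w (i + 1) < w i" "w (j + 1) < w j"
    and chains: "ascent_chain d x (w \<circ> adj i) z" "ascent_chain d x (w \<circ> adj j) z'"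
  shows "d i z = d j z'"
proof -
  have less: "card (inversions (w \<circ> adj i)) < card (inversions w)"
    "card (inversions (w \<circ> adj j)) < card (inversions w)"
    using card_inversions_descent[OF w _ desc(1)] card_inversions_descent[OF w _ desc(2)] ij
    by auto
  have j1: "1 \<le> j" using ij by simp
  show ?thesis
  proof (cases "i + 1 < j")
    case True
    let ?q = "w \<circ> adj i \<circ> adj j"
    obtain q where q: "ascent_chain d x ?q q"
      using ascent_chain_exists[OF S_infinity_adj[OF S_infinity_adj[OF w ij(1)] j1]] ..
    have eq: "w \<circ> adj i = ?q \<circ> adj j" "w \<circ> adj j = ?q \<circ> adj i"
      using True by (auto simp: fun_eq_iff transpose_def)
    have "ascent_chain d x (w \<circ> adj i) (d j q)" "ascent_chain d x (w \<circ> adj j) (d i q)"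
      using True ij desc
      by (intro ascent_chain_step'[OF q j1 _ eq(1)] ascent_chain_step'[OF q ij(1) _ eq(2)];
          simp add: transpose_def)+
    then have "z = d j q" "z' = d i q" using IH[OF less(1) chains(1)] IH[OF less(2) chains(2)] by auto
    then show ?thesis using far_commute True by simp
  next
    case False
    with ij have j: "j = i + 1" by simp
    let ?q = "w \<circ> adj i \<circ> adj j \<circ> adj i"
    obtain q where q: "ascent_chain d x ?q q"
      using ascent_chain_exists[OF S_infinity_adj[OF S_infinity_adj[OF S_infinity_adj[OF w ij(1)] j1] ij(1)]] ..
    have eq: "w \<circ> adj i = ?q \<circ> adj i \<circ> adj j" "w \<circ> adj j = ?q \<circ> adj j \<circ> adj i"
      using j by (auto simp: fun_eq_iff transpose_def)
    have qq: "ascent_chain d x (?q \<circ> adj i) (d i q)" "ascent_chain d x (?q \<circ> adj j) (d j q)"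
      using j ij desc
      by (intro ascent_chain.step[OF q ij(1)] ascent_chain.step[OF q j1]; simp add: transpose_def)+
    have "ascent_chain d x (w \<circ> adj i) (d j (d i q))"
      "ascent_chain d x (w \<circ> adj j) (d i (d j q))"
      using j ij desc
      by (intro ascent_chain_step'[OF qq(1) j1 _ eq(1)] ascent_chain_step'[OF qq(2) ij(1) _ eq(2)];
          simp add: transpose_def)+
    then have "z = d j (d i q)" "z' = d i (d j q)"
      using IH[OF less(1) chains(1)] IH[OF less(2) chains(2)] by auto
    then show ?thesis using braid j by simp
  qed
qed

lemma ascent_chain_unique:
  "ascent_chain d x w y \<Longrightarrow> ascent_chain d x w y' \<Longrightarrow> y = y'"
proof (induction "card (inversions w)" arbitrary: w y y' rule: less_induct)
  case less
  have w: "w \<in> S_infinity" by (rule ascent_chain_S_infinity[OF less.prems(1)])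
  have no_desc: "w \<noteq> id" if "w (i + 1) < w i" for i using that by auto
  show ?case
  proof (cases rule: ascent_chain_cases[OF less.prems(1)])
    case 1
    then show ?thesis using less.prems(2) no_desc by (auto elim: ascent_chain_cases)
  next
    case (2 i z)
    note i = 2
    show ?thesis
    proof (cases rule: ascent_chain_cases[OF less.prems(2)])
      case 1
      then show ?thesis using no_desc i by auto
    next
      case (2 j z')
      consider "i = j" | "i < j" | "j < i" by linarith
      then show ?thesis
      proof cases
        case 1
        have "card (inversions (w \<circ> adj i)) < card (inversions w)"
          using card_inversions_descent[OF w i(1,2)] by simp
        then show ?thesis using less.hyps[of "w \<circ> adj i" z z'] i 2 1 by simp
      next
        case le: 2
        show ?thesis
          using ascent_chain_diamond[OF less.hyps w i(1) le i(2) 2(2) i(3) 2(3)] i 2 by simp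
      next
        case ge: 3
        show ?thesis
          using ascent_chain_diamond[OF less.hyps w 2(1) ge 2(2) i(2) 2(3) i(3)] i 2 by simp
      qed
    qed
  qed
qed

definition along :: "'a \<Rightarrow> (nat \<Rightarrow> nat) \<Rightarrow> 'a" where
  "along x w = (THE y. ascent_chain d x w y)"

lemma along_eqI: "ascent_chain d x w y \<Longrightarrow> along x w = y"
  unfolding along_def using ascent_chain_unique by blast

lemma along_id [simp]: "along x id = x"
  by (intro along_eqI ascent_chain.base)

lemma along_ascent:
  assumes "w \<in> S_infinity" "1 \<le> i" "w i < w (i + 1)"
  shows "along x (w \<circ> adj i) = d i (along x w)"
proof -
  obtain y where "ascent_chain d x w y" using ascent_chain_exists[OF assms(1)] ..
  moreover from this have "ascent_chain d x (w \<circ> adj i) (d i y)"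
    using assms(2,3) by (rule ascent_chain.step)
  ultimately show ?thesis by (simp only: along_eqI)
qed

end

section \<open>Braid relations for divided differences\<close>

text \<open>
  Multiplied by the Vandermonde product, three nested divided differences give the alternating sum
  over all permutations of \<open>a\<close>, \<open>b\<close>, \<open>c\<close>. Reading the variables in the order \<open>c\<close>, \<open>b\<close>, \<open>a\<close> exchanges
  the roles of the two swaps, so the lemma covers both sides of the braid relation.
\<close>

lemma swap_vars_alternating_identity:
  fixes a b c F F1 F2 F3 :: mpoly_int
  assumes st: "s = mpoly_eval x" "t = mpoly_eval y"
    and s: "s a = b" "s b = a" "s c = c" and t: "t a = a" "t b = c" "t c = b"
    and F: "(a - b) * F1 = F - s F" "(b - c) * F2 = F1 - t F1" "(a - b) * F3 = F2 - s F2"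
    and ss: "s (s F) = F" and ne: "a \<noteq> b"
  shows "(a - b) * (a - c) * (b - c) * F3 = F - s F - t F + t (s F) + s (t F) - s (t (s F))"
    (is "?V * F3 = ?R")
proof -
  have t1: "(a - c) * t F1 = t F - t (s F)"
    using arg_cong[OF F(1), of t] t st by simp
  have "?V * F2 = (a - c) * ((a - b) * ((b - c) * F2))" by (simp only: mult_ac)
  also have "\<dots> = (a - c) * ((a - b) * F1) - (a - b) * ((a - c) * t F1)"
    unfolding F(2) by (simp add: algebra_simps)
  finally have v2: "?V * F2 = (a - c) * (F - s F) - (a - b) * (t F - t (s F))"
    unfolding F(1) t1 .
  have "- ?V * s F2 = (b - c) * (s F - F) - (b - a) * (s (t F) - s (t (s F)))"
    using arg_cong[OF v2, of s] s ss st by (simp add: algebra_simps)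
  then have sv2: "?V * s F2 = (b - c) * (F - s F) + (b - a) * (s (t F) - s (t (s F)))"
    by (simp add: algebra_simps)
  have "(a - b) * (?V * F3) = ?V * ((a - b) * F3)" by (simp only: mult_ac)
  also have "\<dots> = ?V * F2 - ?V * s F2" unfolding F(3) by (simp only: right_diff_distrib)
  also have "\<dots> = (a - b) * ?R" unfolding v2 sv2 by (simp add: algebra_simps)
  finally show ?thesis using ne by simp
qed

lemma divided_difference_braid:
  "divided_difference i (divided_difference (i + 1) (divided_difference i F)) =
   divided_difference (i + 1) (divided_difference i (divided_difference (i + 1) F))"
    (is "?L = ?R")
proof -
  let ?a = "Var i" and ?b = "Var (i + 1)" and ?c = "Var (i + 2)"
  let ?s = "swap_vars i" and ?t = "swap_vars (i + 1)"
  let ?x = "\<lambda>k j. Var (adj k j)"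
  have st: "?s = mpoly_eval (?x i)" "?t = mpoly_eval (?x (i + 1))"
    by (auto simp: swap_vars_eval fun_eq_iff)
  have vars: "?s ?a = ?b" "?s ?b = ?a" "?s ?c = ?c" "?t ?a = ?a" "?t ?b = ?c" "?t ?c = ?b"
    by (auto simp: swap_vars_eval transpose_def)
  note dd = divided_difference_mult[of i] divided_difference_mult[of "i + 1", simplified]
  have L: "(?a - ?b) * (?a - ?c) * (?b - ?c) * ?L
      = F - ?s F - ?t F + ?t (?s F) + ?s (?t F) - ?s (?t (?s F))"
    by (rule swap_vars_alternating_identity[OF st vars, of
          "divided_difference i F" F "divided_difference (i + 1) (divided_difference i F)"])
       (use dd in auto)
  have "(?c - ?b) * - divided_difference (i + 1) F = F - ?t F"
    "(?b - ?a) * divided_difference i (divided_difference (i + 1) F)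
      = - divided_difference (i + 1) F - ?s (- divided_difference (i + 1) F)"
    "(?c - ?b) * - ?R = divided_difference i (divided_difference (i + 1) F)
      - ?t (divided_difference i (divided_difference (i + 1) F))"
    using dd[of "divided_difference (i + 1) F"] dd[of F]
      dd[of "divided_difference i (divided_difference (i + 1) F)"]
    by (simp_all add: st) (simp_all add: algebra_simps)
  then have R: "(?c - ?b) * (?c - ?a) * (?b - ?a) * - ?R
      = F - ?t F - ?s F + ?s (?t F) + ?t (?s F) - ?t (?s (?t F))"
    by (rule swap_vars_alternating_identity[OF st(2,1) vars(6,5,4,3,2,1), of
          "- divided_difference (i + 1) F" F "divided_difference i (divided_difference (i + 1) F)"]) auto
  have sign: "(c - b) * (c - a) * (b - a) * - G = (a - b) * (a - c) * (b - c) * G"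
    for a b c G :: mpoly_int by (simp add: algebra_simps)
  have tst: "?t (?s (?t F)) = ?s (?t (?s F))"
    by (auto simp: swap_vars_eval mpoly_eval_eval transpose_def
          intro!: arg_cong[where f = "\<lambda>x. mpoly_eval x F"])
  have "(?a - ?b) * (?a - ?c) * (?b - ?c) * ?L = (?a - ?b) * (?a - ?c) * (?b - ?c) * ?R"
    by (rule trans[OF L trans[OF _ trans[OF R[symmetric] sign]]]) (simp only: tst, simp add: algebra_simps)
  then show ?thesis by simp
qed

lemma divided_difference_commute:
  assumes "i + 1 < j"
  shows "divided_difference i (divided_difference j F) = divided_difference j (divided_difference i F)"
proof -
  have inv: "swap_vars i (Var j - Var (j + 1)) = Var j - Var (j + 1)"
    using assms by (simp add: swap_vars_eval transpose_def)
  have "swap_vars i (swap_vars j F) = swap_vars j (swap_vars i F)"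
    using assms by (auto simp: swap_vars_eval mpoly_eval_eval transpose_def
          intro!: arg_cong[where f = "\<lambda>x. mpoly_eval x F"])
  moreover have "divided_difference i (swap_vars j F) = swap_vars j (divided_difference i F)"
    unfolding swap_vars_eval[of j] using assms
    by (intro mpoly_eval_divided_difference[where c = 1, simplified, symmetric])
       (auto simp: swap_vars_eval transpose_def)
  ultimately show ?thesis
    using divided_difference_invariant_mult[OF inv, of "divided_difference j F"]
    by (intro divided_difference_unique[symmetric])
       (simp only: divided_difference_mult divided_difference_diff)
qed

section \<open>Homogeneous polynomials in finitely many variables\<close>

definition truncate_vars :: "nat \<Rightarrow> mpoly_int \<Rightarrow> mpoly_int" where
  "truncate_vars N = mpoly_eval (\<lambda>i. if 1 \<le> i \<and> i \<le> N then Var i else 0)"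

text \<open>
  The variable \<open>Var 0\<close>, which occurs in no Schubert polynomial, serves as the scaling parameter. In
  this way homogeneity of degree \<open>d\<close> becomes an equation between values of ring homomorphisms, and
  it passes through divided differences by cancelling one factor \<open>Var 0\<close>.
\<close>

definition scale_vars :: "mpoly_int \<Rightarrow> mpoly_int" where
  "scale_vars = mpoly_eval (\<lambda>i. Var 0 * Var i)"

definition constant_term :: "mpoly_int \<Rightarrow> int" where
  "constant_term = mpoly_eval (\<lambda>_. 0)"

text \<open>
  The first conjunct also excludes \<open>Var 0\<close> from \<open>F\<close>.
\<close>

definition homogeneous :: "nat \<Rightarrow> mpoly_int \<Rightarrow> bool" where
  "homogeneous d F \<longleftrightarrow> (\<exists>N. truncate_vars N F = F) \<and> scale_vars F = Var 0 ^ d * F"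

lemma constant_term_simps [simp]:
  "constant_term (F + G) = constant_term F + constant_term G"
  "constant_term (F - G) = constant_term F - constant_term G"
  "constant_term (F * G) = constant_term F * constant_term G"
  "constant_term (of_int c) = c"
  "constant_term (Var i) = 0"
  "constant_term 0 = 0"
  by (simp_all add: constant_term_def)

lemma truncate_vars_mono:
  assumes "truncate_vars N F = F" "N \<le> M"
  shows "truncate_vars M F = F"
proof -
  have "truncate_vars M (truncate_vars N F) = truncate_vars N F"
    unfolding truncate_vars_def mpoly_eval_eval using assms(2)
    by (intro arg_cong[where f = "\<lambda>x. mpoly_eval x F"]) auto
  with assms(1) show ?thesis by simp
qed

lemma truncate_vars_zero: "truncate_vars 0 F = of_int (constant_term F)"
proof -
  have "truncate_vars 0 F = mpoly_eval (\<lambda>_. 0) F"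
    unfolding truncate_vars_def by (intro arg_cong[where f = "\<lambda>x. mpoly_eval x F"]) auto
  then show ?thesis using mpoly_eval_zero_const[of F] by (simp add: constant_term_def)
qed

lemma truncate_vars_divided_difference:
  assumes "truncate_vars N F = F" "1 \<le> i" "i \<le> M" "N \<le> Suc M"
  shows "truncate_vars (Suc M) (divided_difference i F) = divided_difference i F"
proof -
  have "truncate_vars (Suc M) (divided_difference i F) = divided_difference i (truncate_vars (Suc M) F)"
    unfolding truncate_vars_def using assms(2,3)
    by (intro mpoly_eval_divided_difference[where c = 1, simplified])
       (auto simp: swap_vars_eval transpose_def)
  then show ?thesis using truncate_vars_mono[OF assms(1,4)] by simp
qed

lemma divided_difference_beyond_vars:
  assumes "truncate_vars N F = F" "N < i"
  shows "divided_difference i F = 0"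
proof (rule divided_difference_unique)
  have "swap_vars i (truncate_vars N F) = truncate_vars N F"
    unfolding truncate_vars_def swap_vars_eval mpoly_eval_eval using assms(2)
    by (intro arg_cong[where f = "\<lambda>x. mpoly_eval x F"]) (auto simp: transpose_def)
  then show "(Var i - Var (i + 1)) * 0 = F - swap_vars i F" using assms(1) by simp
qed

text \<open>
  Such a polynomial is symmetric in all variables. Exchanging the last variable that may occur with
  the next one, which does not occur, shows that the former does not occur either.
\<close>

lemma divided_differences_zero_imp_constant:
  assumes "truncate_vars N F = F" "\<And>i. 1 \<le> i \<Longrightarrow> divided_difference i F = 0"
  shows "F = of_int (constant_term F)"
  using assms(1)
proof (induction N)
  case 0
  then show ?case using truncate_vars_zero[of F] by simp
next
  case (Suc N)
  have "swap_vars (Suc N) F = F"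
    using divided_difference_mult[of "Suc N" F] assms(2)[of "Suc N"] by simp
  then have "F = truncate_vars (Suc N) (swap_vars (Suc N) (truncate_vars (Suc N) F))"
    using Suc.prems by simp
  also have "\<dots> = truncate_vars N F"
    unfolding truncate_vars_def swap_vars_eval mpoly_eval_eval
    by (intro arg_cong[where f = "\<lambda>x. mpoly_eval x F"]) (auto simp: transpose_def)
  finally show ?case using Suc.IH by simp
qed

lemma homogeneous_divided_difference:
  assumes "homogeneous (Suc d) F" "1 \<le> i"
  shows "homogeneous d (divided_difference i F)"
proof -
  obtain N where N: "truncate_vars N F = F" using assms(1) by (auto simp: homogeneous_def)
  have "truncate_vars (Suc (max N i)) (divided_difference i F) = divided_difference i F"
    by (rule truncate_vars_divided_difference[OF N assms(2)]) auto
  moreover have "scale_vars (divided_difference i F) = Var 0 ^ d * divided_difference i F"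
  proof -
    have inv: "swap_vars i (Var 0 ^ Suc d) = Var 0 ^ Suc d"
      using assms(2) by (simp add: swap_vars_eval transpose_def)
    have "Var 0 * scale_vars (divided_difference i F) = divided_difference i (scale_vars F)"
      unfolding scale_vars_def using assms(2)
      by (intro mpoly_eval_divided_difference) (auto simp: swap_vars_eval transpose_def algebra_simps)
    also have "scale_vars F = Var 0 ^ Suc d * F"
      using assms(1) by (simp add: homogeneous_def)
    also have "divided_difference i (Var 0 ^ Suc d * F) = Var 0 * (Var 0 ^ d * divided_difference i F)"
      unfolding divided_difference_invariant_mult[OF inv] by (simp only: power_Suc mult.assoc)
    finally show ?thesis by (simp only: mult_cancel_left Var_neq_0 simp_thms)
  qed
  ultimately show ?thesis unfolding homogeneous_def by blast
qed

lemma homogeneous_constant_term: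
  assumes "homogeneous d F" "d \<noteq> 0"
  shows "constant_term F = 0"
proof -
  have "constant_term F = constant_term (scale_vars F)"
    by (simp add: constant_term_def scale_vars_def mpoly_eval_eval)
  also have "scale_vars F = Var 0 ^ d * F"
    using assms(1) by (simp add: homogeneous_def)
  also have "constant_term (Var 0 ^ d * F) = 0"
    using assms(2) by (simp add: constant_term_def)
  finally show ?thesis .
qed

text \<open>
  Setting \<open>Var 0\<close> to \<open>0\<close> leaves \<open>F\<close> as it is and reduces the rescaled polynomial to its constant term;
  in degree \<open>0\<close> the two polynomials agree.
\<close>

lemma homogeneous_0_const:
  assumes "homogeneous 0 F"
  shows "F = of_int (constant_term F)"
proof -
  obtain N where N: "truncate_vars N F = F" using assms by (auto simp: homogeneous_def)
  let ?k = "mpoly_eval (\<lambda>i. if i = 0 then 0 else Var i)"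
  have "?k (truncate_vars N F) = truncate_vars N F"
    unfolding truncate_vars_def mpoly_eval_eval
    by (intro arg_cong[where f = "\<lambda>x. mpoly_eval x F"]) auto
  then have "F = ?k (scale_vars F)" using N assms by (simp add: homogeneous_def)
  also have "\<dots> = truncate_vars 0 F"
    unfolding truncate_vars_def scale_vars_def mpoly_eval_eval
    by (intro arg_cong[where f = "\<lambda>x. mpoly_eval x F"]) auto
  finally show ?thesis by (simp only: truncate_vars_zero)
qed

lemma homogeneous_1: "homogeneous 0 1"
  by (auto simp: homogeneous_def truncate_vars_def scale_vars_def)

lemma homogeneous_Var: "1 \<le> i \<Longrightarrow> homogeneous 1 (Var i)"
  by (auto simp: homogeneous_def truncate_vars_def scale_vars_def)

lemma homogeneous_mult:
  assumes "homogeneous d F" "homogeneous e G"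
  shows "homogeneous (d + e) (F * G)"
proof -
  obtain N M where "truncate_vars N F = F" "truncate_vars M G = G"
    using assms by (auto simp: homogeneous_def)
  then have "truncate_vars (max N M) F = F" "truncate_vars (max N M) G = G"
    by (auto intro: truncate_vars_mono)
  then have "truncate_vars (max N M) (F * G) = F * G" by (simp add: truncate_vars_def)
  moreover have "scale_vars (F * G) = Var 0 ^ (d + e) * (F * G)"
    using assms by (simp add: homogeneous_def scale_vars_def power_add algebra_simps)
  ultimately show ?thesis by (auto simp: homogeneous_def)
qed

lemma homogeneous_power: "homogeneous d F \<Longrightarrow> homogeneous (n * d) (F ^ n)"
  by (induction n) (auto intro: homogeneous_1 homogeneous_mult)

lemma homogeneous_prod:
  "(\<And>i. i \<in> A \<Longrightarrow> homogeneous (d i) (F i)) \<Longrightarrow> homogeneous (\<Sum>i\<in>A. d i) (\<Prod>i\<in>A. F i)"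
  by (induction A rule: infinite_finite_induct) (auto intro: homogeneous_1 homogeneous_mult)

section \<open>Schubert polynomials\<close>

interpretation divided_difference: braid_operators divided_difference
  by unfold_locales (rule divided_difference_commute divided_difference_braid; assumption?)+

abbreviation staircase_monomial :: "nat \<Rightarrow> mpoly_int" where
  "staircase_monomial n \<equiv> (\<Prod>i\<in>{1..n}. Var i ^ (n - i))"

lemma long_perm_involution [simp]: "long_perm n (long_perm n i) = i"
  by (auto simp: long_perm_def)

lemma long_perm_comp [simp]: "long_perm n \<circ> long_perm n = id"
  by (simp add: fun_eq_iff)

lemma long_perm_permutes: "long_perm n permutes {1..n}"
  unfolding permutes_def
proof (intro conjI allI impI ex1I)
  fix y
  show "long_perm n (long_perm n y) = y" by simp
  fix x assume "long_perm n x = y"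
  then show "x = long_perm n y" by auto
qed (auto simp: long_perm_def)

lemma long_perm_less:
  "a \<in> {1..n} \<Longrightarrow> b \<in> {1..n} \<Longrightarrow> long_perm n a < long_perm n b \<longleftrightarrow> b < a"
  by (auto simp: long_perm_def)

lemma permutes_in: "w permutes {1..n} \<Longrightarrow> 1 \<le> i \<Longrightarrow> i \<le> n \<Longrightarrow> w i \<in> {1..n}"
  using permutes_in_image[of w "{1..n}" i] by simp

lemma long_perm_comp_permutes: "w permutes {1..n} \<Longrightarrow> long_perm n \<circ> w permutes {1..n}"
  by (intro permutes_compose long_perm_permutes)

lemma card_inversions_long_perm: "card (inversions (long_perm n)) = (\<Sum>i\<in>{1..n}. n - i)"
proof -
  have "inversions (long_perm n) = (SIGMA i:{1..n}. {i + 1..n})"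
    using inversions_subset[OF long_perm_permutes, of n] long_perm_less[of _ n]
    by (fastforce simp: inversions_def)
  then show ?thesis by (simp add: card_SigmaI)
qed

lemma schubert_rel_permutes: "schubert_rel n w F \<Longrightarrow> w permutes {1..n}"
proof (induction rule: schubert_rel.induct)
  case long
  show ?case by (rule long_perm_permutes)
next
  case (descent w F i)
  show ?case by (rule permutes_adj[OF descent.IH descent.hyps(2,3)])
qed

lemma schubert_rel_homogeneous: "schubert_rel n w F \<Longrightarrow> homogeneous (card (inversions w)) F"
proof (induction rule: schubert_rel.induct)
  case long
  have "homogeneous ((n - i) * 1) (Var i ^ (n - i))" if "i \<in> {1..n}" for i
    using that by (intro homogeneous_power homogeneous_Var) auto
  then show ?case
    unfolding card_inversions_long_perm by (intro homogeneous_prod) simp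
next
  case (descent w F i)
  have "w \<in> S_infinity" using schubert_rel_permutes[OF descent.hyps(1)] S_infinity_iff by blast
  note eq = card_inversions_descent[OF this descent.hyps(2,4)]
  show ?case
    by (rule homogeneous_divided_difference[OF descent.IH[unfolded eq] descent.hyps(2)])
qed

text \<open>
  Left multiplication by the long permutation reverses the order of the values, so it turns
  descents into ascents.
\<close>

lemma schubert_rel_imp_ascent_chain:
  "schubert_rel n w F \<Longrightarrow>
     ascent_chain divided_difference (staircase_monomial n) (long_perm n \<circ> w) F"
proof (induction rule: schubert_rel.induct)
  case long
  show ?case unfolding long_perm_comp by (rule ascent_chain.base)
next
  case (descent w F i)
  have "w i \<in> {1..n}" "w (i + 1) \<in> {1..n}"
    using permutes_in[OF schubert_rel_permutes[OF descent.hyps(1)]] descent.hyps(2,3) by simp_all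
  then have "(long_perm n \<circ> w) i < (long_perm n \<circ> w) (i + 1)"
    using descent.hyps(4) long_perm_less by simp
  from ascent_chain.step[OF descent.IH descent.hyps(2) this]
  show ?case by (simp only: comp_assoc)
qed

lemma ascent_chain_imp_schubert_rel:
  "ascent_chain divided_difference (staircase_monomial n) v F \<Longrightarrow> v permutes {1..n} \<Longrightarrow>
     schubert_rel n (long_perm n \<circ> v) F"
proof (induction rule: ascent_chain.induct)
  case base
  show ?case using schubert_rel.long by simp
next
  case (step v F i)
  \<comment> \<open>The new permutation has a descent at \<open>i\<close>, which is impossible from \<open>n\<close> on.\<close>
  have i: "i < n"
  proof (rule ccontr)
    assume "\<not> i < n"
    then have "(v \<circ> adj i) (i + 1) = i + 1"
      by (intro permutes_not_in[OF step.prems]) simp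
    then have "i + 1 < (v \<circ> adj i) i" using step.hyps(3) by simp
    moreover have "(v \<circ> adj i) i \<le> max i n"
      using permutes_in[OF step.prems step.hyps(2)] permutes_not_in[OF step.prems, of i]
      by (cases "i \<le> n") auto
    ultimately show False using \<open>\<not> i < n\<close> by simp
  qed
  have v: "v permutes {1..n}"
    using permutes_adj[OF step.prems step.hyps(2) i] by (simp only: comp_transpose_twice)
  have "v i \<in> {1..n}" "v (i + 1) \<in> {1..n}"
    using permutes_in[OF v] step.hyps(2) i by simp_all
  then have "(long_perm n \<circ> v) (i + 1) < (long_perm n \<circ> v) i"
    using step.hyps(3) long_perm_less by simp
  from schubert_rel.descent[OF step.IH[OF v] step.hyps(2) i this]
  show ?case by (simp only: comp_assoc)
qed

lemma schubert_rel_exists: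
  assumes "w permutes {1..n}"
  shows "\<exists>F. schubert_rel n w F"
proof -
  have v: "long_perm n \<circ> w permutes {1..n}" by (rule long_perm_comp_permutes[OF assms])
  then have "long_perm n \<circ> w \<in> S_infinity" using S_infinity_iff by blast
  from ascent_chain_exists[OF this]
  obtain F where "ascent_chain divided_difference (staircase_monomial n) (long_perm n \<circ> w) F" ..
  from ascent_chain_imp_schubert_rel[OF this v] have "schubert_rel n w F"
    by (simp only: comp_assoc[symmetric] long_perm_comp id_comp)
  then show ?thesis ..
qed

lemma schubert_rel_unique: "schubert_rel n w F \<Longrightarrow> schubert_rel n w G \<Longrightarrow> F = G"
  by (rule divided_difference.ascent_chain_unique) (rule schubert_rel_imp_ascent_chain; assumption)+

text \<open>
  The long permutation of \<open>S\<^sub>n\<^sub>+\<^sub>1\<close> with its largest value moved to position \<open>j + 1\<close>. From \<open>j = 0\<close> to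
  \<open>j = n\<close> these permutations lead from the long permutation of \<open>S\<^sub>n\<^sub>+\<^sub>1\<close> to that of \<open>S\<^sub>n\<close>.
\<close>

definition ladder_perm :: "nat \<Rightarrow> nat \<Rightarrow> nat \<Rightarrow> nat" where
  "ladder_perm n j i =
     (if i = 0 then 0 else if i \<le> j then n + 1 - i else if i = j + 1 then n + 1
      else if i \<le> n + 1 then n + 2 - i else i)"

text \<open>
  At each step the exponents of the two exchanged variables differ by one, so the monomial is a
  symmetric factor times \<open>Var (j + 1)\<close>, and the divided difference removes the latter. The case
  \<open>j = n\<close> yields the compatibility of the recursions inside \<open>S\<^sub>n\<close> and \<open>S\<^sub>n\<^sub>+\<^sub>1\<close>.
\<close>

lemma schubert_rel_ladder:
  "j \<le> n \<Longrightarrow> schubert_rel (Suc n) (ladder_perm n j)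
     ((\<Prod>i\<in>{1..j}. Var i ^ (n - i)) * (\<Prod>i\<in>{j + 1..Suc n}. Var i ^ (Suc n - i)))"
proof (induction j)
  case 0
  have "ladder_perm n 0 = long_perm (Suc n)"
    by (auto simp: ladder_perm_def long_perm_def fun_eq_iff)
  then show ?case using schubert_rel.long[of "Suc n"] by simp
next
  case (Suc j)
  \<comment> \<open>The exchanged variables are \<open>Var (j + 1)\<close> and \<open>Var (j + 2)\<close>; the factors \<open>?A\<close> and \<open>?B\<close> contain neither.\<close>
  let ?i = "j + 1"
  let ?A = "\<Prod>i\<in>{1..j}. Var i ^ (n - i)" and ?B = "\<Prod>i\<in>{j + 3..Suc n}. Var i ^ (Suc n - i)"
  let ?M = "(Var ?i * Var (?i + 1)) ^ (n - j - 1)"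
  let ?F = "?A * (\<Prod>i\<in>{j + 1..Suc n}. Var i ^ (Suc n - i))"
  have n: "n - j = Suc (n - j - 1)" using Suc.prems by simp
  have cuts: "{j + 1..Suc n} = insert (j + 1) (insert (j + 2) {j + 3..Suc n})"
    "{Suc j + 1..Suc n} = insert (j + 2) {j + 3..Suc n}" "{1..Suc j} = insert (Suc j) {1..j}"
    using Suc.prems by auto
  have F: "?F = (?A * ?B * ?M) * Var ?i"
    unfolding cuts using n by (simp add: power_mult_distrib mult_ac)
  have G: "(\<Prod>i\<in>{1..Suc j}. Var i ^ (n - i)) * (\<Prod>i\<in>{Suc j + 1..Suc n}. Var i ^ (Suc n - i))
      = ?A * ?B * ?M"
    unfolding cuts using n by (simp add: power_mult_distrib mult_ac)
  have inv: "swap_vars ?i (?A * ?B * ?M) = ?A * ?B * ?M"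
  proof -
    have "swap_vars ?i ?A = ?A" "swap_vars ?i ?B = ?B"
      unfolding swap_vars_eval mpoly_eval_prod
      by (intro prod.cong refl; simp add: transpose_def)+
    moreover have "swap_vars ?i ?M = ?M" by (simp add: swap_vars_eval mult.commute)
    ultimately show ?thesis by (simp add: swap_vars_eval)
  qed
  have "divided_difference ?i (Var ?i) = 1"
    by (rule divided_difference_unique) (simp add: swap_vars_eval)
  then have "divided_difference ?i ?F = ?A * ?B * ?M"
    unfolding F divided_difference_invariant_mult[OF inv] by simp
  moreover have "ladder_perm n (Suc j) = ladder_perm n j \<circ> adj ?i"
    using Suc.prems by (auto simp: ladder_perm_def fun_eq_iff transpose_def)
  moreover have "schubert_rel (Suc n) (ladder_perm n j \<circ> adj ?i) (divided_difference ?i ?F)"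
    using Suc.prems by (intro schubert_rel.descent Suc.IH) (auto simp: ladder_perm_def)
  ultimately show ?case by (simp only: G)
qed

lemma schubert_rel_Suc: "schubert_rel n w F \<Longrightarrow> schubert_rel (Suc n) w F"
proof (induction rule: schubert_rel.induct)
  case long
  have "ladder_perm n n = long_perm n"
    by (auto simp: ladder_perm_def long_perm_def fun_eq_iff)
  then show ?case using schubert_rel_ladder[of n n] by simp
next
  case (descent w F i)
  show ?case
    using descent.IH descent.hyps(2) less_SucI[OF descent.hyps(3)] descent.hyps(4)
    by (rule schubert_rel.descent)
qed

lemma schubert_rel_mono: "n \<le> m \<Longrightarrow> schubert_rel n w F \<Longrightarrow> schubert_rel m w F"
  by (induction m rule: dec_induct) (blast intro: schubert_rel_Suc)+

lemma schubert_eqI: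
  assumes "schubert_rel n w F"
  shows "schubert w = F"
  unfolding schubert_def
proof (rule the_equality)
  show "\<exists>n. schubert_rel n w F" using assms ..
  fix G assume "\<exists>m. schubert_rel m w G"
  then obtain m where "schubert_rel m w G" ..
  then show "G = F"
    using assms schubert_rel_mono[of m "max m n" w G] schubert_rel_mono[of n "max m n" w F]
      schubert_rel_unique[of "max m n" w G F] by simp
qed

lemma schubert_rel_schubert: "w permutes {1..n} \<Longrightarrow> schubert_rel n w (schubert w)"
  using schubert_rel_exists schubert_eqI by blast

lemma schubert_id [simp]: "schubert id = 1"
proof -
  have "long_perm 0 = id" by (auto simp: long_perm_def fun_eq_iff)
  then show ?thesis using schubert_eqI[OF schubert_rel.long[of 0]] by simp
qed

lemma schubert_homogeneous: "w \<in> S_infinity \<Longrightarrow> homogeneous (card (inversions w)) (schubert w)"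
  using schubert_rel_homogeneous schubert_rel_schubert S_infinity_iff by blast

lemma divided_difference_schubert_descent:
  assumes "w \<in> S_infinity" "1 \<le> i" "w (i + 1) < w i"
  shows "divided_difference i (schubert w) = schubert (w \<circ> adj i)"
proof -
  obtain n where "w permutes {1..n}" using assms(1) S_infinity_iff by blast
  then have "w permutes {1..n + i + 1}" by (rule permutes_subset) auto
  then have "schubert_rel (n + i + 1) (w \<circ> adj i) (divided_difference i (schubert w))"
    using assms(2,3) schubert_rel.descent[OF schubert_rel_schubert, of w "n + i + 1" i] by simp
  then show ?thesis by (rule schubert_eqI[symmetric])
qed

lemma divided_difference_schubert_ascent:
  assumes "w \<in> S_infinity" "1 \<le> i" "w i < w (i + 1)"
  shows "divided_difference i (schubert w) = 0"
proof -
  have "divided_difference i (schubert (w \<circ> adj i)) = schubert (w \<circ> adj i \<circ> adj i)"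
    using assms(3)
    by (intro divided_difference_schubert_descent S_infinity_adj[OF assms(1,2)] assms(2)) simp
  then have "schubert w = divided_difference i (schubert (w \<circ> adj i))"
    by (simp only: comp_transpose_twice)
  then show ?thesis by simp
qed

section \<open>The functionals dual to Schubert polynomials\<close>

interpretation dual: braid_operators "\<lambda>i h F. (h :: mpoly_int \<Rightarrow> int) (divided_difference i F)"
proof
  fix i j :: nat and y :: "mpoly_int \<Rightarrow> int"
  assume "i + 1 < j"
  then show "(\<lambda>F. y (divided_difference j (divided_difference i F)))
      = (\<lambda>F. y (divided_difference i (divided_difference j F)))"
    by (intro ext arg_cong[where f = y] divided_difference_commute[symmetric])
qed (simp only: divided_difference_braid)

text \<open>
  The constant term of \<open>\<partial>\<^sub>w F\<close>, where \<open>\<partial>\<^sub>w\<close> composes the divided differences along a reduced word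
  of \<open>w\<close>. These functionals read off coefficients with respect to Schubert polynomials.
\<close>

definition schubert_dual :: "(nat \<Rightarrow> nat) \<Rightarrow> mpoly_int \<Rightarrow> int" where
  "schubert_dual w = dual.along constant_term w"

lemma schubert_dual_id [simp]: "schubert_dual id F = constant_term F"
  by (simp only: schubert_dual_def dual.along_id)

lemma schubert_dual_ascent:
  assumes "w \<in> S_infinity" "1 \<le> i" "w i < w (i + 1)"
  shows "schubert_dual (w \<circ> adj i) F = schubert_dual w (divided_difference i F)"
  unfolding schubert_dual_def dual.along_ascent[OF assms] ..

lemma schubert_dual_descent:
  assumes "w \<in> S_infinity" "1 \<le> i" "w (i + 1) < w i"
  shows "schubert_dual w F = schubert_dual (w \<circ> adj i) (divided_difference i F)"
proof -
  have "schubert_dual (w \<circ> adj i \<circ> adj i) F = schubert_dual (w \<circ> adj i) (divided_difference i F)"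
    using assms(3) by (intro schubert_dual_ascent S_infinity_adj[OF assms(1,2)] assms(2)) simp
  then show ?thesis by (simp only: comp_transpose_twice)
qed

lemma schubert_dual_add:
  "w \<in> S_infinity \<Longrightarrow> schubert_dual w (F + G) = schubert_dual w F + schubert_dual w G"
  by (induction arbitrary: F G rule: S_infinity_induct)
     (simp_all only: schubert_dual_id schubert_dual_ascent divided_difference_add constant_term_simps)

lemma schubert_dual_const_mult:
  "w \<in> S_infinity \<Longrightarrow> schubert_dual w (of_int c * F) = c * schubert_dual w F"
  by (induction arbitrary: F rule: S_infinity_induct)
     (simp_all only: schubert_dual_id schubert_dual_ascent divided_difference_const_mult constant_term_simps)

lemma schubert_dual_0: "w \<in> S_infinity \<Longrightarrow> schubert_dual w 0 = 0"
  using schubert_dual_const_mult[of w 0 0] by simp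

lemma schubert_dual_diff:
  "w \<in> S_infinity \<Longrightarrow> schubert_dual w (F - G) = schubert_dual w F - schubert_dual w G"
  using schubert_dual_add[of w "F - G" G] by simp

lemma schubert_dual_sum:
  "w \<in> S_infinity \<Longrightarrow> schubert_dual w (\<Sum>a\<in>A. f a) = (\<Sum>a\<in>A. schubert_dual w (f a))"
  by (induction A rule: infinite_finite_induct) (simp_all add: schubert_dual_add schubert_dual_0)

lemma schubert_dual_divided_difference_descent:
  assumes "w \<in> S_infinity" "1 \<le> i" "w (i + 1) < w i"
  shows "schubert_dual w (divided_difference i F) = 0"
  unfolding schubert_dual_descent[OF assms] divided_difference_square
  by (rule schubert_dual_0[OF S_infinity_adj[OF assms(1,2)]])

lemma adj_cases:
  assumes "w \<in> S_infinity"
  obtains "w i < w (i + 1)" | "w (i + 1) < w i"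
  using S_infinity_eq_iff[OF assms, of i "i + 1"] by (metis less_add_one less_irrefl linorder_neqE_nat)

lemma constant_term_schubert:
  assumes "u \<in> S_infinity"
  shows "constant_term (schubert u) = (if u = id then 1 else 0)"
proof (cases "u = id")
  case True
  then show ?thesis using constant_term_simps(4)[of 1] by simp
next
  case False
  obtain i where "1 \<le> i" "u (i + 1) < u i" by (rule S_infinity_descent[OF assms False])
  from card_inversions_descent[OF assms this] have "card (inversions u) \<noteq> 0" by simp
  from homogeneous_constant_term[OF schubert_homogeneous[OF assms] this] False
  show ?thesis by simp
qed

lemma schubert_dual_schubert:
  "w \<in> S_infinity \<Longrightarrow> u \<in> S_infinity \<Longrightarrow>
     schubert_dual w (schubert u) = (if u = w then 1 else 0)"
proof (induction arbitrary: u rule: S_infinity_induct)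
  case id
  then show ?case by (simp only: schubert_dual_id constant_term_schubert)
next
  case (ascent w i)
  have eq: "schubert_dual (w \<circ> adj i) (schubert u) = schubert_dual w (divided_difference i (schubert u))"
    by (rule schubert_dual_ascent[OF ascent.hyps])
  show ?case
  proof (rule adj_cases[OF ascent.prems, of i])
    assume a: "u i < u (i + 1)"
    have "schubert_dual (w \<circ> adj i) (schubert u) = 0"
      unfolding eq divided_difference_schubert_ascent[OF ascent.prems ascent.hyps(2) a]
      by (rule schubert_dual_0[OF ascent.hyps(1)])
    moreover have "u \<noteq> w \<circ> adj i" using a ascent.hyps(3) by auto
    ultimately show ?case by (simp only: if_False)
  next
    assume a: "u (i + 1) < u i"
    have "schubert_dual (w \<circ> adj i) (schubert u) = (if u \<circ> adj i = w then 1 else 0)"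
      unfolding eq divided_difference_schubert_descent[OF ascent.prems ascent.hyps(2) a]
      by (rule ascent.IH[OF S_infinity_adj[OF ascent.prems ascent.hyps(2)]])
    moreover have "u \<circ> adj i = w \<longleftrightarrow> u = w \<circ> adj i"
      using comp_transpose_twice by metis
    ultimately show ?case by (simp only:)
  qed
qed

lemma truncate_vars_sum:
  assumes "finite A" "\<And>a. a \<in> A \<Longrightarrow> \<exists>N. truncate_vars N (f a) = f a"
  shows "\<exists>N. truncate_vars N (\<Sum>a\<in>A. f a) = (\<Sum>a\<in>A. f a)"
  using assms
proof (induction A)
  case empty
  show ?case by (simp add: truncate_vars_def)
next
  case (insert a A)
  obtain N M where "truncate_vars N (f a) = f a" "truncate_vars M (\<Sum>a\<in>A. f a) = (\<Sum>a\<in>A. f a)"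
    using insert.IH insert.prems by (meson insertCI)
  then have "truncate_vars (max N M) (f a) = f a"
    "truncate_vars (max N M) (\<Sum>a\<in>A. f a) = (\<Sum>a\<in>A. f a)"
    by (auto intro: truncate_vars_mono)
  then have "truncate_vars (max N M) (f a + (\<Sum>a\<in>A. f a)) = f a + (\<Sum>a\<in>A. f a)"
    by (simp add: truncate_vars_def)
  then show ?case using insert.hyps by auto
qed

lemma permutes_S_infinity: "w permutes {1..n} \<Longrightarrow> w \<in> S_infinity"
  by (auto simp only: S_infinity_iff)

text \<open>
  By induction on the degree, the two sides have the same divided differences, since applying
  \<open>\<partial>\<^sub>i\<close> to the right-hand side permutes its terms. The difference is therefore a constant, and it
  has constant term \<open>0\<close> in positive degree.
\<close>

lemma schubert_expansion:
  "homogeneous d F \<Longrightarrow> truncate_vars N F = F \<Longrightarrow>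
     F = (\<Sum>w | w permutes {1..N + d}. of_int (schubert_dual w F) * schubert w)"
proof (induction d arbitrary: N F)
  case 0
  let ?c = "constant_term F"
  have F: "F = of_int ?c" using homogeneous_0_const[OF 0(1)] .
  have "of_int (schubert_dual w F) * schubert w = (if w = id then of_int ?c else 0)"
    if "w permutes {1..N}" for w
  proof -
    have "schubert_dual w F = ?c * schubert_dual w (schubert id)"
      using schubert_dual_const_mult[OF permutes_S_infinity[OF that], of ?c "schubert id"] F by simp
    also have "schubert_dual w (schubert id) = (if id = w then 1 else 0)"
      by (rule schubert_dual_schubert[OF permutes_S_infinity[OF that] id_in_S_infinity])
    finally show ?thesis by auto
  qed
  then have "(\<Sum>w | w permutes {1..N + 0}. of_int (schubert_dual w F) * schubert w)
      = (\<Sum>w | w permutes {1..N}. if w = id then of_int ?c else 0)"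
    by (intro sum.cong) simp_all
  also have "\<dots> = of_int ?c"
    using finite_permutations[of "{1..N}"] by (simp add: sum.delta permutes_id)
  finally show ?case using F by metis
next
  case (Suc d)
  let ?M = "N + Suc d"
  let ?P = "{w. w permutes {1..?M}}"
  let ?S = "\<Sum>w\<in>?P. of_int (schubert_dual w F) * schubert w"
  have fin: "finite ?P" by (rule finite_permutations) simp
  have P: "w \<in> ?P \<Longrightarrow> w \<in> S_infinity" for w using permutes_S_infinity by blast
  have dd: "divided_difference i (F - ?S) = 0" if i: "1 \<le> i" for i
  proof (cases "i \<le> N")
    case False
    then have z: "divided_difference i F = 0"
      using divided_difference_beyond_vars[OF Suc.prems(2)] by simp
    \<comment> \<open>Here \<open>\<partial>\<^sub>i F = 0\<close>, so terms with a descent at \<open>i\<close> have coefficient \<open>0\<close>; the others are annihilated by \<open>\<partial>\<^sub>i\<close>.\<close>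
    have "of_int (schubert_dual w F) * divided_difference i (schubert w) = 0" if "w \<in> ?P" for w
    proof (rule adj_cases[OF P[OF that], of i])
      assume "w i < w (i + 1)"
      then show ?thesis using divided_difference_schubert_ascent[OF P[OF that] i] by simp
    next
      assume "w (i + 1) < w i"
      from schubert_dual_descent[OF P[OF that] i this, of F]
      have "schubert_dual w F = 0"
        unfolding z by (simp only: schubert_dual_0[OF S_infinity_adj[OF P[OF that] i]])
      then show ?thesis by simp
    qed
    then have "(\<Sum>w\<in>?P. of_int (schubert_dual w F) * divided_difference i (schubert w)) = 0"
      by (intro sum.neutral ballI)
    then show ?thesis
      by (simp only: divided_difference_diff divided_difference_sum divided_difference_const_mult z
            diff_self)
  next
    case True
    have bij: "w \<circ> adj i \<in> ?P" if "w \<in> ?P" for w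
      using permutes_adj[of w ?M i] that True i by simp
    have "divided_difference i F
        = (\<Sum>v\<in>?P. of_int (schubert_dual v (divided_difference i F)) * schubert v)"
      using Suc.IH[OF homogeneous_divided_difference[OF Suc.prems(1) i]
          truncate_vars_divided_difference[OF Suc.prems(2) i True]] by simp
    \<comment> \<open>Right multiplication by \<open>s\<^sub>i\<close> matches the terms; it preserves \<open>S\<^sub>M\<close> because \<open>i \<le> N < M\<close>.\<close>
    also have "\<dots> = (\<Sum>w\<in>?P. of_int (schubert_dual w F) * divided_difference i (schubert w))"
    proof (rule sum.reindex_bij_witness[where i = "\<lambda>w. w \<circ> adj i" and j = "\<lambda>w. w \<circ> adj i"])
      fix v assume v: "v \<in> ?P"
      show "of_int (schubert_dual (v \<circ> adj i) F) * divided_difference i (schubert (v \<circ> adj i))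
          = of_int (schubert_dual v (divided_difference i F)) * schubert v"
      proof (rule adj_cases[OF P[OF v], of i])
        assume a: "v i < v (i + 1)"
        have "divided_difference i (schubert (v \<circ> adj i)) = schubert (v \<circ> adj i \<circ> adj i)"
          using a by (intro divided_difference_schubert_descent P[OF bij[OF v]] i) simp
        then show ?thesis
          by (simp only: schubert_dual_ascent[OF P[OF v] i a] comp_transpose_twice)
      next
        assume a: "v (i + 1) < v i"
        have "divided_difference i (schubert (v \<circ> adj i)) = 0"
          using a by (intro divided_difference_schubert_ascent P[OF bij[OF v]] i) simp
        then show ?thesis
          by (simp only: schubert_dual_divided_difference_descent[OF P[OF v] i a]
                of_int_0 mult_zero_left mult_zero_right)
      qed
    qed (rule comp_transpose_twice bij; assumption?)+
    also have "\<dots> = divided_difference i ?S"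
      by (simp only: divided_difference_sum divided_difference_const_mult)
    finally show ?thesis by (simp only: divided_difference_diff diff_self)
  qed
  have ex: "\<exists>N. truncate_vars N (of_int (schubert_dual w F) * schubert w)
      = of_int (schubert_dual w F) * schubert w" if w: "w \<in> ?P" for w
  proof -
    obtain N where "truncate_vars N (schubert w) = schubert w"
      using schubert_homogeneous[OF P[OF w]] by (auto simp only: homogeneous_def)
    then have "truncate_vars N (of_int (schubert_dual w F) * schubert w)
        = of_int (schubert_dual w F) * schubert w"
      by (simp add: truncate_vars_def)
    then show ?thesis ..
  qed
  from truncate_vars_sum[OF fin, of "\<lambda>w. of_int (schubert_dual w F) * schubert w", OF ex]
  obtain K where K: "truncate_vars K ?S = ?S" ..
  have "truncate_vars (max N K) F = F" "truncate_vars (max N K) ?S = ?S"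
    using truncate_vars_mono[OF Suc.prems(2)] truncate_vars_mono[OF K] by simp_all
  then have "truncate_vars (max N K) (F - ?S) = F - ?S" by (simp add: truncate_vars_def)
  then have const: "F - ?S = of_int (constant_term (F - ?S))"
    using dd by (rule divided_differences_zero_imp_constant)
  have F0: "constant_term F = 0" by (rule homogeneous_constant_term[OF Suc.prems(1)]) simp
  have "constant_term ?S = schubert_dual id ?S" by simp
  also have "\<dots> = (\<Sum>w\<in>?P. schubert_dual w F * schubert_dual id (schubert w))"
    by (simp only: schubert_dual_sum schubert_dual_const_mult id_in_S_infinity)
  also have "\<dots> = 0"
  proof (rule sum.neutral, rule ballI)
    fix w assume "w \<in> ?P"
    then show "schubert_dual w F * schubert_dual id (schubert w) = 0"
      using F0 constant_term_schubert[OF P] by (cases "w = id") simp_all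
  qed
  finally have "F - ?S = 0" using const F0 by simp
  then show ?case by simp
qed

lemma schubert_expansion_coeff:
  fixes c :: "(nat \<Rightarrow> nat) \<Rightarrow>\<^sub>0 int"
  assumes "Poly_Mapping.keys c \<subseteq> S_infinity" "z \<in> S_infinity"
    and "F = (\<Sum>w\<in>Poly_Mapping.keys c. of_int (Poly_Mapping.lookup c w) * schubert w)"
  shows "Poly_Mapping.lookup c z = schubert_dual z F"
proof -
  have "schubert_dual z F
      = (\<Sum>w\<in>Poly_Mapping.keys c. Poly_Mapping.lookup c w * schubert_dual z (schubert w))"
    by (simp only: assms(3) schubert_dual_sum[OF assms(2)] schubert_dual_const_mult[OF assms(2)])
  also have "\<dots> = (\<Sum>w\<in>Poly_Mapping.keys c. if w = z then Poly_Mapping.lookup c z else 0)"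
    using assms(1) schubert_dual_schubert[OF assms(2)] by (intro sum.cong) auto
  also have "\<dots> = Poly_Mapping.lookup c z" by (simp add: sum.delta in_keys_iff)
  finally show ?thesis ..
qed

lemma schubert_coeff_eq_dual:
  assumes "u \<in> S_infinity" "v \<in> S_infinity" "w \<in> S_infinity"
  shows "schubert_coeff u v w = schubert_dual w (schubert u * schubert v)"
proof -
  let ?F = "schubert u * schubert v"
  let ?d = "card (inversions u) + card (inversions v)"
  have hom: "homogeneous ?d ?F"
    by (intro homogeneous_mult schubert_homogeneous assms)
  then obtain N where N: "truncate_vars N ?F = ?F" by (auto simp only: homogeneous_def)
  let ?P = "{z. z permutes {1..N + ?d}}"
  have fin: "finite ?P" by (rule finite_permutations) simp
  define c where "c = Abs_poly_mapping (\<lambda>z. if z \<in> ?P then schubert_dual z ?F else 0)"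
  have lookup: "Poly_Mapping.lookup c z = (if z \<in> ?P then schubert_dual z ?F else 0)" for z
    unfolding c_def by (subst lookup_Abs_poly_mapping) (rule finite_subset[OF _ fin], auto)
  have keys: "Poly_Mapping.keys c \<subseteq> ?P"
    by (rule subsetI) (simp only: in_keys_iff lookup split: if_splits)
  let ?expands = "\<lambda>c :: (nat \<Rightarrow> nat) \<Rightarrow>\<^sub>0 int. Poly_Mapping.keys c \<subseteq> S_infinity \<and>
        ?F = (\<Sum>z\<in>Poly_Mapping.keys c. of_int (Poly_Mapping.lookup c z) * schubert z)"
  have "?expands c"
  proof
    show "Poly_Mapping.keys c \<subseteq> S_infinity" using keys permutes_S_infinity by blast
    have "?F = (\<Sum>z\<in>?P. of_int (Poly_Mapping.lookup c z) * schubert z)"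
      using schubert_expansion[OF hom N] by (simp add: lookup)
    also have "\<dots> = (\<Sum>z\<in>Poly_Mapping.keys c. of_int (Poly_Mapping.lookup c z) * schubert z)"
      using fin keys by (intro sum.mono_neutral_right) (auto simp: in_keys_iff)
    finally show "?F = (\<Sum>z\<in>Poly_Mapping.keys c. of_int (Poly_Mapping.lookup c z) * schubert z)" .
  qed
  moreover have "c' = c" if "?expands c'" for c'
  proof (rule poly_mapping_eqI)
    fix z
    show "Poly_Mapping.lookup c' z = Poly_Mapping.lookup c z"
    proof (cases "z \<in> S_infinity")
      case True
      then show ?thesis
        using schubert_expansion_coeff[of c' z ?F] schubert_expansion_coeff[of c z ?F]
          that \<open>?expands c\<close> by simp
    next
      case False
      then have "z \<notin> Poly_Mapping.keys c'" "z \<notin> Poly_Mapping.keys c"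
        using that \<open>?expands c\<close> by blast+
      then show ?thesis by (simp add: in_keys_iff)
    qed
  qed
  ultimately have "(THE c. ?expands c) = c" by (rule the_equality)
  then have "schubert_coeff u v w = Poly_Mapping.lookup c w"
    unfolding schubert_coeff_def by (rule arg_cong)
  also have "\<dots> = schubert_dual w ?F"
    using \<open>?expands c\<close> assms(3) schubert_expansion_coeff by blast
  finally show ?thesis .
qed

section \<open>Schubert coefficients and parabolic subgroups\<close>

text \<open>
  A permutation preserves the cut after \<open>m\<close> if no reduced word of it contains \<open>s\<^sub>m\<close>.
\<close>

definition preserves_cut :: "nat \<Rightarrow> (nat \<Rightarrow> nat) \<Rightarrow> bool" where
  "preserves_cut m w \<longleftrightarrow> (\<forall>i. w i \<le> m \<longleftrightarrow> i \<le> m)"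

text \<open>
  The subgroup generated by the transpositions \<open>s\<^sub>i\<close> with \<open>i \<in> J\<close>, described by the cuts that its
  elements preserve.
\<close>

definition parabolic :: "nat set \<Rightarrow> (nat \<Rightarrow> nat) set" where
  "parabolic J = {w \<in> S_infinity. \<forall>m. m \<notin> J \<longrightarrow> preserves_cut m w}"

lemma parabolic_S_infinity: "w \<in> parabolic J \<Longrightarrow> w \<in> S_infinity"
  by (simp add: parabolic_def)

lemma id_in_parabolic [simp]: "id \<in> parabolic J"
  by (simp add: parabolic_def preserves_cut_def)

lemma adj_le_iff: "m \<noteq> i \<Longrightarrow> adj i j \<le> m \<longleftrightarrow> j \<le> m"
  by (auto simp: transpose_def)

lemma preserves_cut_adj:
  assumes "m \<noteq> i"
  shows "preserves_cut m (w \<circ> adj i) \<longleftrightarrow> preserves_cut m w"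
proof
  assume *: "preserves_cut m (w \<circ> adj i)"
  show "preserves_cut m w"
    unfolding preserves_cut_def
  proof
    fix j
    have "(w \<circ> adj i) (adj i j) \<le> m \<longleftrightarrow> adj i j \<le> m"
      using * unfolding preserves_cut_def by blast
    then show "w j \<le> m \<longleftrightarrow> j \<le> m" using adj_le_iff[OF assms, of j] by simp
  qed
next
  assume "preserves_cut m w"
  then show "preserves_cut m (w \<circ> adj i)"
    using adj_le_iff[OF assms] by (simp add: preserves_cut_def)
qed

lemma parabolic_adj:
  assumes "w \<in> parabolic J" "i \<in> J" "1 \<le> i"
  shows "w \<circ> adj i \<in> parabolic J"
  unfolding parabolic_def mem_Collect_eq
proof (intro conjI allI impI)
  show "w \<circ> adj i \<in> S_infinity" by (rule S_infinity_adj[OF parabolic_S_infinity[OF assms(1)] assms(3)])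
  fix m assume m: "m \<notin> J"
  then have "m \<noteq> i" "preserves_cut m w" using assms(1,2) by (auto simp: parabolic_def)
  then show "preserves_cut m (w \<circ> adj i)" by (rule preserves_cut_adj[THEN iffD2])
qed

lemma parabolic_descent:
  assumes "w \<in> parabolic J" "w (i + 1) < w i"
  shows "i \<in> J"
proof (rule ccontr)
  assume "i \<notin> J"
  then have cut: "w j \<le> i \<longleftrightarrow> j \<le> i" for j using assms(1) by (simp add: parabolic_def preserves_cut_def)
  show False using cut[of i] cut[of "i + 1"] assms(2) by simp
qed

text \<open>
  A descent of \<open>w\<close> is a cut that \<open>w\<close> does not preserve. Hence it lies in \<open>J\<close>, and the chain of
  ascents that leads to \<open>w\<close> stays inside the parabolic subgroup.
\<close>

lemma parabolic_induct [consumes 1, case_names id ascent]: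
  assumes "w \<in> parabolic J" "P id"
    and ascent: "\<And>w i. w \<in> parabolic J \<Longrightarrow> i \<in> J \<Longrightarrow> 1 \<le> i \<Longrightarrow> w i < w (i + 1) \<Longrightarrow> P w
      \<Longrightarrow> P (w \<circ> adj i)"
  shows "P w"
proof -
  have "w \<in> parabolic J \<longrightarrow> P w"
    using parabolic_S_infinity[OF assms(1)]
  proof (induction rule: S_infinity_induct)
    case id
    show ?case using assms(2) by (rule impI)
  next
    case (ascent w i)
    show ?case
    proof
      assume w: "w \<circ> adj i \<in> parabolic J"
      have i: "i \<in> J" by (rule parabolic_descent[OF w]) (use ascent.hyps(3) in simp)
      from parabolic_adj[OF w i ascent.hyps(2)] have "w \<in> parabolic J"
        by (simp only: comp_transpose_twice)
      then show "P (w \<circ> adj i)" using assms(3) i ascent.hyps(2,3) ascent.IH by blast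
    qed
  qed
  then show ?thesis using assms(1) ..
qed

definition dual_kernel :: "nat set \<Rightarrow> mpoly_int set" where
  "dual_kernel J = {F. \<forall>w\<in>parabolic J. schubert_dual w F = 0}"

lemma dual_kernel_divided_difference:
  assumes "F \<in> dual_kernel J" "i \<in> J" "1 \<le> i"
  shows "divided_difference i F \<in> dual_kernel J"
  unfolding dual_kernel_def mem_Collect_eq
proof
  fix w assume w: "w \<in> parabolic J"
  note S = parabolic_S_infinity[OF w]
  show "schubert_dual w (divided_difference i F) = 0"
  proof (rule adj_cases[OF S, of i])
    assume "w i < w (i + 1)"
    from schubert_dual_ascent[OF S assms(3) this, of F]
    have "schubert_dual w (divided_difference i F) = schubert_dual (w \<circ> adj i) F" by (rule sym)
    also have "\<dots> = 0"
      using assms(1) parabolic_adj[OF w assms(2,3)] by (simp only: dual_kernel_def mem_Collect_eq)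
    finally show ?thesis .
  qed (rule schubert_dual_divided_difference_descent[OF S assms(3)])
qed

text \<open>
  The common kernel of the functionals of a parabolic subgroup is an ideal. The Leibniz rule with
  \<open>s\<^sub>i F = F - (x\<^sub>i - x\<^sub>i\<^sub>+\<^sub>1) \<partial>\<^sub>i F\<close> writes \<open>\<partial>\<^sub>i (F G)\<close> as a sum of multiples of \<open>F\<close> and \<open>\<partial>\<^sub>i F\<close>, both of
  which lie in the kernel, and the functional that remains belongs to a shorter permutation.
\<close>

lemma dual_kernel_mult:
  assumes "F \<in> dual_kernel J"
  shows "F * G \<in> dual_kernel J"
proof -
  have "\<forall>F G. F \<in> dual_kernel J \<longrightarrow> schubert_dual w (F * G) = 0" if "w \<in> parabolic J" for w
    using that
  proof (induction rule: parabolic_induct)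
    case id
    show ?case
    proof (intro allI impI)
      fix F G assume "F \<in> dual_kernel J"
      then have "schubert_dual id F = 0" using id_in_parabolic by (simp only: dual_kernel_def mem_Collect_eq)
      then show "schubert_dual id (F * G) = 0" by simp
    qed
  next
    case (ascent w i)
    show ?case
    proof (intro allI impI)
      fix F G assume F: "F \<in> dual_kernel J"
      let ?d = "divided_difference i"
      note S = parabolic_S_infinity[OF ascent.hyps(1)]
      note dF = dual_kernel_divided_difference[OF F ascent.hyps(2,3)]
      have "schubert_dual w (F * ?d G) = 0" "schubert_dual w (?d F * G) = 0"
        "schubert_dual w (?d F * ((Var i - Var (i + 1)) * ?d G)) = 0"
        using ascent.IH F dF by blast+
      moreover have "?d (F * G) = ?d F * G + F * ?d G - ?d F * ((Var i - Var (i + 1)) * ?d G)"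
        unfolding divided_difference_Leibniz swap_vars_conv_divided_difference
        by (simp add: algebra_simps)
      ultimately have "schubert_dual w (?d (F * G)) = 0"
        by (simp only: schubert_dual_add[OF S] schubert_dual_diff[OF S])
      then show "schubert_dual (w \<circ> adj i) (F * G) = 0"
        by (simp only: schubert_dual_ascent[OF S ascent.hyps(3,4)])
    qed
  qed
  then show ?thesis using assms unfolding dual_kernel_def by blast
qed

lemma schubert_in_dual_kernel:
  assumes "u \<in> S_infinity" "u \<notin> parabolic J"
  shows "schubert u \<in> dual_kernel J"
  unfolding dual_kernel_def mem_Collect_eq
proof
  fix w assume w: "w \<in> parabolic J"
  then have "u \<noteq> w" using assms(2) by blast
  then show "schubert_dual w (schubert u) = 0"
    using schubert_dual_schubert[OF parabolic_S_infinity[OF w] assms(1)] by (simp only: if_False)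
qed

text \<open>
  If one of the factors lies outside the parabolic subgroup, then its Schubert polynomial is in
  the kernel of all functionals of the subgroup. The product is then in the kernel as well.
\<close>

lemma schubert_coeff_nonzero_parabolic:
  assumes "u \<in> S_infinity" "v \<in> S_infinity" "w \<in> parabolic J" "schubert_coeff u v w \<noteq> 0"
  shows "u \<in> parabolic J \<and> v \<in> parabolic J"
proof -
  have ne: "schubert u * schubert v \<notin> dual_kernel J"
    using assms(3,4) schubert_coeff_eq_dual[OF assms(1,2) parabolic_S_infinity[OF assms(3)]]
    unfolding dual_kernel_def by auto
  have "schubert u \<notin> dual_kernel J" using ne dual_kernel_mult by blast
  moreover have "schubert v \<notin> dual_kernel J"
    using ne dual_kernel_mult[of "schubert v" J "schubert u"] by (simp only: mult.commute) blast
  ultimately show ?thesis using schubert_in_dual_kernel assms(1,2) by blast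
qed

section \<open>Inserting a fixed point\<close>

definition shift :: "nat \<Rightarrow> nat \<Rightarrow> nat" where
  "shift m i = (if i \<le> m then i else Suc i)"

definition unshift :: "nat \<Rightarrow> nat \<Rightarrow> nat" where
  "unshift m i = (if i \<le> m then i else i - 1)"

text \<open>
  The conjugate of \<open>w\<close> under the increasing renumbering \<open>shift m\<close>, whose image leaves out \<open>m + 1\<close>.
\<close>

definition insert_fixed_point :: "nat \<Rightarrow> (nat \<Rightarrow> nat) \<Rightarrow> nat \<Rightarrow> nat" where
  "insert_fixed_point m w i = (if i = Suc m then i else shift m (w (unshift m i)))"

text \<open>
  The effect of removing the fixed point \<open>m + 1\<close> on variables: the other variables are renumbered
  against \<open>shift m\<close>, and \<open>0\<close> is the value for which the constant term does not change.
\<close>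

definition delete_var :: "nat \<Rightarrow> mpoly_int \<Rightarrow> mpoly_int" where
  "delete_var m = mpoly_eval (\<lambda>j. if j = Suc m then 0 else Var (unshift m j))"

lemma unshift_shift [simp]: "unshift m (shift m i) = i"
  by (auto simp: shift_def unshift_def)

lemma shift_neq [simp]: "shift m i \<noteq> Suc m" "Suc m \<noteq> shift m i"
  by (auto simp: shift_def)

lemma shift_unshift: "i \<noteq> Suc m \<Longrightarrow> shift m (unshift m i) = i"
  by (auto simp: shift_def unshift_def)

lemma shift_less_iff [simp]: "shift m i < shift m j \<longleftrightarrow> i < j"
  by (auto simp: shift_def)

lemma inj_shift: "inj (shift m)"
  by (rule injI) (metis unshift_shift)

lemma shift_Suc: "i \<noteq> m \<Longrightarrow> shift m (i + 1) = shift m i + 1"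
  by (auto simp: shift_def)

lemma insert_fixed_point_shift [simp]: "insert_fixed_point m w (shift m i) = shift m (w i)"
  by (simp add: insert_fixed_point_def)

lemma insert_fixed_point_eq_iff: "insert_fixed_point m w = insert_fixed_point m w' \<longleftrightarrow> w = w'"
proof
  assume eq: "insert_fixed_point m w = insert_fixed_point m w'"
  show "w = w'"
  proof
    fix i
    have "shift m (w i) = shift m (w' i)"
      using fun_cong[OF eq, of "shift m i"] by simp
    then show "w i = w' i" by (metis unshift_shift)
  qed
qed simp

lemma insert_fixed_point_id: "insert_fixed_point m id = id"
  by (auto simp: insert_fixed_point_def shift_unshift fun_eq_iff)

lemma insert_fixed_point_adj:
  assumes "i \<noteq> m"
  shows "insert_fixed_point m (w \<circ> adj i) = insert_fixed_point m w \<circ> adj (shift m i)"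
proof
  fix j
  show "insert_fixed_point m (w \<circ> adj i) j = (insert_fixed_point m w \<circ> adj (shift m i)) j"
  proof (cases "j = Suc m")
    case True
    then have "adj (shift m i) j = j" using assms by (auto simp: shift_def transpose_def)
    then show ?thesis using True by (simp add: insert_fixed_point_def)
  next
    case False
    define l where "l = unshift m j"
    have j: "j = shift m l" using shift_unshift[OF False] by (simp add: l_def)
    have "adj (shift m i) (shift m l) = shift m (adj i l)"
      using assms by (auto simp: shift_def transpose_def)
    then show ?thesis unfolding j by simp
  qed
qed

lemma insert_fixed_point_ascent:
  assumes "i \<noteq> m" "w i < w (i + 1)"
  shows "insert_fixed_point m w (shift m i) < insert_fixed_point m w (shift m i + 1)"
  unfolding shift_Suc[OF assms(1), symmetric] insert_fixed_point_shift shift_less_iff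
  by (rule assms(2))

lemma delete_var_divided_difference:
  assumes "i \<noteq> m" "1 \<le> i"
  shows "delete_var m (divided_difference (shift m i) F) = divided_difference i (delete_var m F)"
  unfolding delete_var_def using assms
  by (intro mpoly_eval_divided_difference[where c = 1, simplified])
     (auto simp: swap_vars_eval transpose_def shift_def unshift_def)

lemma shift_ge_1: "1 \<le> i \<Longrightarrow> 1 \<le> shift m i"
  by (auto simp: shift_def)

text \<open>
  For \<open>i \<noteq> m\<close> inserting a fixed point takes the ascent \<open>i\<close> to the ascent \<open>shift m i\<close>, and deleting the
  variable takes \<open>\<partial>\<close> at \<open>shift m i\<close> to \<open>\<partial>\<close> at \<open>i\<close>. The three claims follow by one induction because
  the recursions for the length and for the functional also require the new permutation to be in
  \<open>S\<^sub>\<infinity>\<close>.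
\<close>

lemma insert_fixed_point_parabolic:
  assumes "w \<in> parabolic J" "m \<notin> J"
  shows "insert_fixed_point m w \<in> parabolic (shift m ` J) \<and>
    card (inversions (insert_fixed_point m w)) = card (inversions w) \<and>
    (\<forall>F. schubert_dual w (delete_var m F) = schubert_dual (insert_fixed_point m w) F)"
  using assms(1)
proof (induction rule: parabolic_induct)
  case id
  have "constant_term (delete_var m F) = constant_term F" for F
    unfolding constant_term_def delete_var_def mpoly_eval_eval
    by (intro arg_cong[where f = "\<lambda>x. mpoly_eval x F"]) (auto simp: fun_eq_iff)
  then show ?case
    by (simp only: insert_fixed_point_id id_in_parabolic schubert_dual_id simp_thms)
next
  case (ascent w i)
  let ?w = "insert_fixed_point m w"
  have im: "i \<noteq> m" using ascent.hyps(2) assms(2) by blast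
  note S = parabolic_S_infinity[OF ascent.hyps(1)]
  have S': "?w \<in> S_infinity" using ascent.IH parabolic_S_infinity by blast
  note i' = shift_ge_1[OF ascent.hyps(3), of m]
  note asc = insert_fixed_point_ascent[OF im ascent.hyps(4)]
  show ?case unfolding insert_fixed_point_adj[OF im]
  proof (intro conjI allI)
    show "?w \<circ> adj (shift m i) \<in> parabolic (shift m ` J)"
      using ascent.IH ascent.hyps(2) by (intro parabolic_adj i' imageI) blast+
    show "card (inversions (?w \<circ> adj (shift m i))) = card (inversions (w \<circ> adj i))"
      unfolding card_inversions_ascent[OF S' asc] card_inversions_ascent[OF S ascent.hyps(4)]
      using ascent.IH by simp
    fix F
    have "schubert_dual (w \<circ> adj i) (delete_var m F)
        = schubert_dual w (delete_var m (divided_difference (shift m i) F))"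
      by (simp only: schubert_dual_ascent[OF S ascent.hyps(3,4)]
            delete_var_divided_difference[OF im ascent.hyps(3)])
    also have "\<dots> = schubert_dual ?w (divided_difference (shift m i) F)"
      using ascent.IH by blast
    also have "\<dots> = schubert_dual (?w \<circ> adj (shift m i)) F"
      by (rule schubert_dual_ascent[OF S' i' asc, symmetric])
    finally show "schubert_dual (w \<circ> adj i) (delete_var m F)
        = schubert_dual (?w \<circ> adj (shift m i)) F" .
  qed
qed

lemma delete_var_schubert:
  assumes "u \<in> parabolic J" "m \<notin> J"
  shows "delete_var m (schubert (insert_fixed_point m u)) - schubert u \<in> dual_kernel J"
  unfolding dual_kernel_def mem_Collect_eq
proof
  fix w assume w: "w \<in> parabolic J"
  note S = parabolic_S_infinity[OF w] parabolic_S_infinity[OF assms(1)]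
  have S': "insert_fixed_point m w \<in> S_infinity" "insert_fixed_point m u \<in> S_infinity"
    using insert_fixed_point_parabolic[OF _ assms(2)] w assms(1) parabolic_S_infinity by blast+
  have "schubert_dual w (delete_var m (schubert (insert_fixed_point m u)))
      = schubert_dual (insert_fixed_point m w) (schubert (insert_fixed_point m u))"
    using insert_fixed_point_parabolic[OF w assms(2)] by blast
  also have "\<dots> = schubert_dual w (schubert u)"
    by (simp only: schubert_dual_schubert[OF S'] schubert_dual_schubert[OF S] insert_fixed_point_eq_iff)
  finally show "schubert_dual w (delete_var m (schubert (insert_fixed_point m u)) - schubert u) = 0"
    by (simp only: schubert_dual_diff[OF S(1)] diff_self)
qed

text \<open>
  The functional of \<open>w\<close> vanishes on the ideal \<open>dual_kernel J\<close>, and modulo this ideal each Schubert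
  polynomial of a permutation with a new fixed point becomes, on deleting the variable, that of
  the original permutation. Deleting a variable is a ring homomorphism, so this applies to the product.
\<close>

lemma schubert_coeff_insert_fixed_point:
  assumes "u \<in> parabolic J" "v \<in> parabolic J" "w \<in> parabolic J" "m \<notin> J"
  shows "schubert_coeff (insert_fixed_point m u) (insert_fixed_point m v) (insert_fixed_point m w)
    = schubert_coeff u v w"
proof -
  let ?g = "insert_fixed_point m"
  let ?a = "delete_var m (schubert (?g u))" and ?b = "delete_var m (schubert (?g v))"
  note S = parabolic_S_infinity[OF assms(1)] parabolic_S_infinity[OF assms(2)]
    parabolic_S_infinity[OF assms(3)]
  have S': "?g u \<in> S_infinity" "?g v \<in> S_infinity" "?g w \<in> S_infinity"
    using insert_fixed_point_parabolic[OF _ assms(4)] assms(1-3) parabolic_S_infinity by blast+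
  have "schubert_coeff (?g u) (?g v) (?g w) = schubert_dual (?g w) (schubert (?g u) * schubert (?g v))"
    by (rule schubert_coeff_eq_dual[OF S'])
  also have "\<dots> = schubert_dual w (delete_var m (schubert (?g u) * schubert (?g v)))"
    using insert_fixed_point_parabolic[OF assms(3,4)] by metis
  also have "delete_var m (schubert (?g u) * schubert (?g v)) = ?a * ?b"
    by (simp add: delete_var_def)
  also have "?a * ?b = schubert u * schubert v + (?a - schubert u) * ?b + (?b - schubert v) * schubert u"
    by (simp add: algebra_simps)
  also have "schubert_dual w \<dots> = schubert_dual w (schubert u * schubert v)"
    using dual_kernel_mult[OF delete_var_schubert[OF assms(1,4)], of ?b]
      dual_kernel_mult[OF delete_var_schubert[OF assms(2,4)], of "schubert u"] assms(3)
    by (simp only: schubert_dual_add[OF S(3)] dual_kernel_def mem_Collect_eq add_0_right)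
  also have "\<dots> = schubert_coeff u v w"
    by (rule schubert_coeff_eq_dual[OF S, symmetric])
  finally show ?thesis .
qed

text \<open>
  The generators of the parabolic subgroup of \<open>shift m ` J\<close> are the images of those of the parabolic
  subgroup of \<open>J\<close>, so the chain of ascents that leads to \<open>w\<close> can be lifted step by step.
\<close>

lemma insert_fixed_point_surj:
  assumes "w \<in> parabolic (shift m ` J)" "m \<notin> J"
  shows "\<exists>v\<in>parabolic J. w = insert_fixed_point m v"
  using assms(1)
proof (induction rule: parabolic_induct)
  case id
  show ?case by (rule bexI[of _ id]) (simp_all only: insert_fixed_point_id id_in_parabolic)
next
  case (ascent w i')
  obtain i where i: "i \<in> J" "i' = shift m i" using ascent.hyps(2) by blast
  obtain v where v: "v \<in> parabolic J" "w = insert_fixed_point m v" using ascent.IH by blast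
  have "i \<noteq> m" using i(1) assms(2) by blast
  have "1 \<le> i"
  proof (rule ccontr)
    assume "\<not> 1 \<le> i"
    then have "i = 0" by simp
    then show False using ascent.hyps(3) i(2) \<open>i \<noteq> m\<close> by (simp add: shift_def)
  qed
  from parabolic_adj[OF v(1) i(1) this]
  show ?case
    by (rule bexI[rotated]) (simp only: v(2) i(2) insert_fixed_point_adj[OF \<open>i \<noteq> m\<close>])
qed

section \<open>Supports\<close>

definition support :: "(nat \<Rightarrow> nat) \<Rightarrow> nat set" where
  "support w = {m. \<not> preserves_cut m w}"

lemma parabolic_iff_support: "w \<in> parabolic J \<longleftrightarrow> w \<in> S_infinity \<and> support w \<subseteq> J"
  by (auto simp: parabolic_def support_def)

lemma support_adj: "support (w \<circ> adj i) \<subseteq> insert i (support w)"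
  using preserves_cut_adj[of _ i w] by (auto simp only: support_def)

text \<open>
  Each ascent in a chain adds one inversion and at most one element of the support.
\<close>

lemma support_card: "w \<in> S_infinity \<Longrightarrow> finite (support w) \<and> card (support w) \<le> card (inversions w)"
proof (induction rule: S_infinity_induct)
  case id
  have "support id = {}" by (simp add: support_def preserves_cut_def)
  then show ?case by (simp only: finite.emptyI card.empty le0 simp_thms)
next
  case (ascent w i)
  have "finite (support (w \<circ> adj i))"
    using ascent.IH support_adj finite_subset by blast
  moreover have "card (support (w \<circ> adj i)) \<le> card (insert i (support w))"
    using ascent.IH by (intro card_mono support_adj) simp
  moreover have "card (insert i (support w)) \<le> Suc (card (support w))"
    by (rule card_insert_le_m1) simp_all
  ultimately show ?case
    using conjunct2[OF ascent.IH] card_inversions_ascent[OF ascent.hyps(1,3)] by linarith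
qed

lemma permutes_iff_support: "w permutes {1..n} \<longleftrightarrow> w \<in> S_infinity \<and> support w \<subseteq> {1..<n}"
proof
  assume w: "w permutes {1..n}"
  have cut: "preserves_cut m w" if "m \<notin> {1..<n}" for m
    unfolding preserves_cut_def
  proof
    fix i
    show "w i \<le> m \<longleftrightarrow> i \<le> m"
      using that permutes_in[OF w, of i] permutes_not_in[OF w, of i]
      by (cases "i \<in> {1..n}") auto
  qed
  show "w \<in> S_infinity \<and> support w \<subseteq> {1..<n}"
    using permutes_S_infinity[OF w] cut unfolding support_def by blast
next
  assume w: "w \<in> S_infinity \<and> support w \<subseteq> {1..<n}"
  then have cut: "w i \<le> m \<longleftrightarrow> i \<le> m" if "n \<le> m" for m i
    using that by (force simp: support_def preserves_cut_def)
  have "w i = i" if "i \<notin> {1..n}" for i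
  proof (cases "i = 0")
    case True
    then show ?thesis using w S_infinity_fixes_0 by simp
  next
    case False
    with that have "n \<le> i" "n \<le> i - 1" by simp_all
    then show ?thesis using cut[of i i] cut[of "i - 1" i] False by linarith
  qed
  moreover have "bij w" using w S_infinity_bij by blast
  ultimately show "w permutes {1..n}"
    unfolding permutes_def by (metis bij_pointE)
qed

text \<open>
  One inclusion says that the new permutation lies in the shifted parabolic subgroup. For the other
  one, a smaller support of the new permutation would lift to a smaller support of \<open>w\<close>.
\<close>

lemma support_insert_fixed_point:
  assumes "w \<in> parabolic J" "m \<notin> J"
  shows "support (insert_fixed_point m w) = shift m ` support w"
proof
  have m: "m \<notin> support w" using assms by (auto simp: parabolic_iff_support)
  have "w \<in> parabolic (support w)" using assms(1) by (simp add: parabolic_iff_support)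
  from insert_fixed_point_parabolic[OF this m]
  have g: "insert_fixed_point m w \<in> S_infinity"
    and sub: "support (insert_fixed_point m w) \<subseteq> shift m ` support w"
    by (auto simp only: parabolic_iff_support)
  then show "support (insert_fixed_point m w) \<subseteq> shift m ` support w" by blast
  \<comment> \<open>The support of the new permutation is the image of some \<open>K\<close>, and lifting shows that \<open>w\<close> has support in \<open>K\<close>.\<close>
  from sub obtain K where K: "K \<subseteq> support w" "support (insert_fixed_point m w) = shift m ` K"
    by (auto simp: subset_image_iff)
  have "m \<notin> K" using K(1) m by blast
  moreover have "insert_fixed_point m w \<in> parabolic (shift m ` K)"
    using g K(2) by (simp add: parabolic_iff_support)
  ultimately obtain v where "v \<in> parabolic K" "insert_fixed_point m w = insert_fixed_point m v"
    using insert_fixed_point_surj by blast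
  then have "support w \<subseteq> K" by (simp add: insert_fixed_point_eq_iff parabolic_iff_support)
  then show "shift m ` support w \<subseteq> support (insert_fixed_point m w)" using K by blast
qed

definition triples :: "nat \<Rightarrow> nat set \<Rightarrow> ((nat \<Rightarrow> nat) \<times> (nat \<Rightarrow> nat) \<times> (nat \<Rightarrow> nat)) set" where
  "triples k J = {(u, v, w). u \<in> parabolic J \<and> v \<in> parabolic J \<and> w \<in> S_infinity \<and>
     support w = J \<and> card (inversions w) = k}"

definition support_sum :: "nat \<Rightarrow> nat set \<Rightarrow> int" where
  "support_sum k J = (\<Sum>(u, v, w)\<in>triples k J. schubert_coeff u v w)"

lemma support_sum_shift:
  assumes "m \<notin> J"
  shows "support_sum k (shift m ` J) = support_sum k J"
proof -
  let ?g = "insert_fixed_point m"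
  let ?h = "\<lambda>(u, v, w). (?g u, ?g v, ?g w)"
  have par: "w \<in> parabolic J" if "w \<in> S_infinity" "support w = J" for w J
    using that by (simp add: parabolic_iff_support)
  have into: "?h t \<in> triples k (shift m ` J)" if "t \<in> triples k J" for t
  proof -
    obtain u v w where t: "t = (u, v, w)" "u \<in> parabolic J" "v \<in> parabolic J" "w \<in> S_infinity"
      "support w = J" "card (inversions w) = k"
      using \<open>t \<in> triples k J\<close> by (auto simp: triples_def)
    note w = par[OF t(4,5)]
    have "?g u \<in> parabolic (shift m ` J)" "?g v \<in> parabolic (shift m ` J)"
      "?g w \<in> parabolic (shift m ` J)" "card (inversions (?g w)) = k"
      using insert_fixed_point_parabolic[OF _ assms] t(2,3,6) w by blast+
    moreover have "support (?g w) = shift m ` J"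
      using support_insert_fixed_point[OF w assms] t(5) by simp
    ultimately show ?thesis
      using parabolic_S_infinity[of "?g w"] t(1) by (simp add: triples_def)
  qed
  have onto: "t \<in> ?h ` triples k J" if "t \<in> triples k (shift m ` J)" for t
  proof -
    obtain u v w where t: "t = (u, v, w)" "u \<in> parabolic (shift m ` J)" "v \<in> parabolic (shift m ` J)"
      "w \<in> S_infinity" "support w = shift m ` J" "card (inversions w) = k"
      using \<open>t \<in> triples k (shift m ` J)\<close> by (auto simp: triples_def)
    obtain u0 v0 w0 where p: "u0 \<in> parabolic J" "v0 \<in> parabolic J" "w0 \<in> parabolic J"
      and eq: "u = ?g u0" "v = ?g v0" "w = ?g w0"
      using insert_fixed_point_surj[OF t(2) assms] insert_fixed_point_surj[OF t(3) assms]
        insert_fixed_point_surj[OF par[OF t(4,5)] assms] by blast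
    have "shift m ` support w0 = shift m ` J"
      using support_insert_fixed_point[OF p(3) assms] t(5) eq(3) by simp
    then have "support w0 = J" using inj_shift by (simp add: inj_image_eq_iff)
    moreover have "card (inversions w0) = k"
      using insert_fixed_point_parabolic[OF p(3) assms] t(6) eq(3) by simp
    ultimately have "(u0, v0, w0) \<in> triples k J"
      using p parabolic_S_infinity by (simp add: triples_def)
    then have "?h (u0, v0, w0) \<in> ?h ` triples k J" by (rule imageI)
    then show ?thesis using t(1) eq by simp
  qed
  have inj: "inj_on ?h (triples k J)"
    by (rule inj_onI) (auto simp: insert_fixed_point_eq_iff)
  have "?h ` triples k J = triples k (shift m ` J)" using into onto by blast
  then have "support_sum k (shift m ` J) = (\<Sum>t\<in>?h ` triples k J. case t of (u, v, w) \<Rightarrow> schubert_coeff u v w)"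
    by (simp add: support_sum_def)
  also have "\<dots> = (\<Sum>t\<in>triples k J. case ?h t of (u, v, w) \<Rightarrow> schubert_coeff u v w)"
    by (simp only: sum.reindex[OF inj] comp_def)
  also have "\<dots> = support_sum k J"
    unfolding support_sum_def
  proof (rule sum.cong[OF refl], clarify)
    fix u v w assume "(u, v, w) \<in> triples k J"
    then have "u \<in> parabolic J" "v \<in> parabolic J" "w \<in> parabolic J"
      by (auto simp: triples_def par)
    then show "schubert_coeff (?g u) (?g v) (?g w) = schubert_coeff u v w"
      using schubert_coeff_insert_fixed_point assms by blast
  qed
  finally show ?thesis .
qed

text \<open>
  On the left \<open>u\<close> and \<open>v\<close> range over \<open>S\<^sub>n\<close>, in \<open>support_sum\<close> over the parabolic subgroup of the support
  of \<open>w\<close>, which is contained in \<open>S\<^sub>n\<close>. The additional terms on the left are zero.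
\<close>

lemma schubert_coeff_sum_by_support:
  "schubert_coeff_sum k n = (\<Sum>J | J \<subseteq> {1..<n} \<and> card J \<le> k. support_sum k J)"
proof -
  let ?P = "{w. w permutes {1..n}}"
  let ?T = "{(u, v, w). u permutes {1..n} \<and> v permutes {1..n} \<and> w permutes {1..n} \<and>
        inv_number n w = k}"
  let ?\<J> = "{J. J \<subseteq> {1..<n} \<and> card J \<le> k}"
  let ?c = "\<lambda>(u, v, w). schubert_coeff u v w"
  let ?s = "\<lambda>(u :: nat \<Rightarrow> nat, v :: nat \<Rightarrow> nat, w). support w"
  have fin_P: "finite ?P" by (rule finite_permutations) simp
  have "?T \<subseteq> ?P \<times> ?P \<times> ?P" by auto
  then have fin_T: "finite ?T" by (rule finite_subset) (intro finite_cartesian_product fin_P)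
  have fin_J: "finite ?\<J>" by simp
  have s: "?s ` ?T \<subseteq> ?\<J>"
    using permutes_iff_support[of _ n] support_card inv_number_eq[of _ n] by fastforce
  have fiber: "sum ?c {t \<in> ?T. ?s t = J} = support_sum k J" if J: "J \<in> ?\<J>" for J
    unfolding support_sum_def
  proof (rule sum.mono_neutral_right)
    show "finite {t \<in> ?T. ?s t = J}" using fin_T by simp
    have "w \<in> parabolic J \<Longrightarrow> w permutes {1..n}" for w
      using J unfolding parabolic_iff_support permutes_iff_support by blast
    moreover have "w \<in> S_infinity \<Longrightarrow> support w = J \<Longrightarrow> w permutes {1..n}" for w
      using J unfolding permutes_iff_support by blast
    ultimately show "triples k J \<subseteq> {t \<in> ?T. ?s t = J}"
      using inv_number_eq[of _ n] by (fastforce simp: triples_def)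
    show "\<forall>t\<in>{t \<in> ?T. ?s t = J} - triples k J. ?c t = 0"
    proof (clarify, rule ccontr)
      fix u v w
      assume t: "u permutes {1..n}" "v permutes {1..n}" "w permutes {1..n}" "k = inv_number n w"
        "J = support w" "(u, v, w) \<notin> triples (inv_number n w) (support w)" "schubert_coeff u v w \<noteq> 0"
      then have "w \<in> parabolic (support w)"
        using permutes_S_infinity by (simp add: parabolic_iff_support)
      from schubert_coeff_nonzero_parabolic[OF _ _ this t(7)] t show False
        using permutes_S_infinity inv_number_eq[of w n] by (auto simp: triples_def)
    qed
  qed
  have "schubert_coeff_sum k n = sum ?c ?T"
    by (simp only: schubert_coeff_sum_def)
  also have "\<dots> = (\<Sum>J\<in>?\<J>. sum ?c {t \<in> ?T. ?s t = J})"
    by (rule sum.group[OF fin_T fin_J s, symmetric])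
  also have "\<dots> = (\<Sum>J\<in>?\<J>. support_sum k J)"
    by (rule sum.cong[OF refl fiber])
  finally show ?thesis .
qed

section \<open>Counting supports\<close>

text \<open>
  Polynomial functions are represented in the basis of binomial coefficients, in which summation
  shifts the index by Pascal's rule.
\<close>

definition binomial_combination :: "nat \<Rightarrow> (nat \<Rightarrow> int) \<Rightarrow> bool" where
  "binomial_combination d f \<longleftrightarrow> (\<exists>c. \<forall>t. f t = (\<Sum>j\<le>d. c j * int (t choose j)))"

lemma binomial_combination_mono:
  assumes "binomial_combination d f" "d \<le> e"
  shows "binomial_combination e f"
proof -
  obtain c where c: "\<And>t. f t = (\<Sum>j\<le>d. c j * int (t choose j))"
    using assms(1) by (auto simp: binomial_combination_def)
  have "f t = (\<Sum>j\<le>e. (if j \<le> d then c j else 0) * int (t choose j))" for t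
    unfolding c using assms(2) by (intro sum.mono_neutral_cong_left) auto
  then show ?thesis by (auto simp: binomial_combination_def)
qed

lemma binomial_combination_add:
  assumes "binomial_combination d f" "binomial_combination d g"
  shows "binomial_combination d (\<lambda>t. f t + g t)"
proof -
  obtain a b where "\<And>t. f t = (\<Sum>j\<le>d. a j * int (t choose j))"
    "\<And>t. g t = (\<Sum>j\<le>d. b j * int (t choose j))"
    using assms by (auto simp: binomial_combination_def)
  then have "f t + g t = (\<Sum>j\<le>d. (a j + b j) * int (t choose j))" for t
    by (simp add: sum.distrib distrib_right)
  then show ?thesis by (auto simp: binomial_combination_def)
qed

lemma binomial_combination_0: "binomial_combination d (\<lambda>_. 0)"
  unfolding binomial_combination_def by (rule exI[of _ "\<lambda>_. 0"]) simp

lemma binomial_combination_sum: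
  "(\<And>a. a \<in> A \<Longrightarrow> binomial_combination d (f a)) \<Longrightarrow> binomial_combination d (\<lambda>t. \<Sum>a\<in>A. f a t)"
  by (induction A rule: infinite_finite_induct)
     (auto intro: binomial_combination_0 binomial_combination_add)

lemma binomial_combination_summation:
  assumes "binomial_combination d h" "\<And>t. f (Suc t) = f t + h t"
  shows "binomial_combination (Suc d) f"
proof -
  obtain c where c: "\<And>t. h t = (\<Sum>j\<le>d. c j * int (t choose j))"
    using assms(1) by (auto simp: binomial_combination_def)
  \<comment> \<open>Pascal's rule moves the coefficients up by one index and leaves the initial value in index \<open>0\<close>.\<close>
  let ?c = "case_nat (f 0) c"
  have "f t = (\<Sum>j\<le>Suc d. ?c j * int (t choose j))" for t
  proof (induction t)
    case 0
    show ?case by (simp add: sum.atMost_Suc_shift del: sum.atMost_Suc)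
  next
    case (Suc t)
    then show ?case
      by (simp add: assms(2) c sum.atMost_Suc_shift sum.distrib distrib_left algebra_simps del: sum.atMost_Suc)
  qed
  then show ?thesis unfolding binomial_combination_def by blast
qed

lemma binomial_polynomial: "\<exists>p :: rat poly. \<forall>t. poly p (of_nat t) = of_nat (t choose j)"
proof -
  let ?p = "smult (1 / fact j) (\<Prod>i\<in>{0..<j}. [:- of_nat i, 1:]) :: rat poly"
  have "poly ?p (of_nat t) = of_nat (t choose j)" for t
  proof -
    have "rat_of_nat (t choose j) = (\<Prod>i = 0..<j. of_nat t - of_nat i) / fact j"
      by (rule trans[OF binomial_gbinomial gbinomial_prod_rev])
    then show ?thesis by (simp add: poly_prod uminus_add_conv_diff)
  qed
  then show ?thesis by blast
qed

lemma binomial_combination_polynomial: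
  assumes "binomial_combination d f"
  shows "\<exists>p :: rat poly. \<forall>t. of_int (f t) = poly p (of_nat t)"
proof -
  obtain c where c: "\<And>t. f t = (\<Sum>j\<le>d. c j * int (t choose j))"
    using assms by (auto simp: binomial_combination_def)
  obtain B :: "nat \<Rightarrow> rat poly" where B: "\<And>j t. poly (B j) (of_nat t) = of_nat (t choose j)"
    using binomial_polynomial by metis
  have "of_int (f t) = poly (\<Sum>j\<le>d. smult (of_int (c j)) (B j)) (of_nat t)" for t
    by (simp add: c B poly_sum)
  then show ?thesis by blast
qed

text \<open>
  Lengthening a gap between two runs of consecutive elements, or the gap before the first run,
  does not change the value.
\<close>

definition gap_invariant :: "(nat set \<Rightarrow> int) \<Rightarrow> bool" where
  "gap_invariant g \<longleftrightarrow> (\<forall>J m. finite J \<longrightarrow> 0 \<notin> J \<longrightarrow> m \<notin> J \<longrightarrow> g (shift m ` J) = g J)"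

text \<open>
  The set that begins with the run \<open>1, ..., a\<close>, omits \<open>a + 1\<close>, and continues with a translate of \<open>J\<close>.
  With \<open>0 \<notin> J\<close> this is a unique decomposition of finite sets of positive numbers.
\<close>

definition after_run :: "nat \<Rightarrow> nat set \<Rightarrow> nat set" where
  "after_run a J = {1..a} \<union> (\<lambda>i. i + a + 1) ` J"

lemma gap_invariant_after_run:
  assumes "gap_invariant g"
  shows "gap_invariant (\<lambda>J. g (after_run a J))"
  unfolding gap_invariant_def
proof (intro allI impI)
  fix J :: "nat set" and m :: nat assume J: "finite J" "0 \<notin> J" "m \<notin> J"
  have "shift (m + a + 1) ` after_run a J = after_run a (shift m ` J)"
    unfolding after_run_def image_Un image_image
    by (intro arg_cong2[where f = "(\<union>)"] image_cong) (auto simp: shift_def image_def)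
  moreover have "finite (after_run a J)" "0 \<notin> after_run a J" "m + a + 1 \<notin> after_run a J"
    using J by (auto simp: after_run_def)
  ultimately show "g (after_run a (shift m ` J)) = g (after_run a J)"
    using assms by (metis gap_invariant_def)
qed

lemma card_after_run:
  assumes "finite J"
  shows "card (after_run a J) = a + card J"
proof -
  have "card ({1..a} \<union> (\<lambda>i. i + a + 1) ` J) = card {1..a} + card ((\<lambda>i. i + a + 1) ` J)"
    using assms by (intro card_Un_disjoint) auto
  then show ?thesis by (simp add: after_run_def card_image inj_on_def)
qed

lemma after_run_unique:
  assumes "after_run a J = after_run b K" "0 \<notin> J" "0 \<notin> K"
  shows "a = b \<and> J = K"
proof -
  have run: "i \<in> after_run a J" if "1 \<le> i" "i \<le> a" for a i J
    using that by (simp add: after_run_def)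
  have gap: "a + 1 \<notin> after_run a J" if "0 \<notin> J" for a J
    using that by (auto simp: after_run_def)
  have "\<not> a + 1 \<le> b"
    using gap[OF assms(2), of a] run[of "a + 1" b K] assms(1) by fastforce
  moreover have "\<not> b + 1 \<le> a"
    using gap[OF assms(3), of b] run[of "b + 1" a J] assms(1) by fastforce
  ultimately have ab: "a = b" by simp
  have mem: "i \<in> J \<longleftrightarrow> i + a + 1 \<in> after_run a J" for i J
    by (auto simp: after_run_def)
  have "i \<in> J \<longleftrightarrow> i \<in> K" for i
    unfolding mem[of i J] mem[of i K] using assms(1) ab by metis
  then have "J = K" by (intro set_eqI)
  with ab show ?thesis ..
qed

lemma after_run_exists:
  assumes "finite J" "0 \<notin> J"
  shows "\<exists>a K. 0 \<notin> K \<and> J = after_run a K"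
proof -
  have "\<exists>a. a + 1 \<notin> J"
    using assms(1) by (metis finite_nat_set_iff_bounded less_irrefl Suc_eq_plus1 less_Suc_eq)
  then have gap: "(LEAST a. a + 1 \<notin> J) + 1 \<notin> J" by (rule LeastI_ex)
  define a where "a = (LEAST a. a + 1 \<notin> J)"
  have run: "i + 1 \<in> J" if "i < a" for i
    using that not_less_Least unfolding a_def by blast
  let ?K = "{i. i + a + 1 \<in> J}"
  have "i \<in> J \<longleftrightarrow> i \<in> after_run a ?K" for i
  proof (cases "i \<le> a")
    case True
    then show ?thesis using assms(2) run[of "i - 1"] by (cases i) (auto simp: after_run_def)
  next
    case False
    then have "i = (i - a - 1) + a + 1" by simp
    then show ?thesis
      using False unfolding after_run_def by (auto simp: image_iff intro!: exI[of _ "i - a - 1"])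
  qed
  then have "J = after_run a ?K" by (intro set_eqI)
  moreover have "0 \<notin> ?K" using gap by (simp add: a_def)
  ultimately show ?thesis by (intro exI conjI)
qed

definition subset_sum :: "(nat set \<Rightarrow> int) \<Rightarrow> nat \<Rightarrow> nat \<Rightarrow> int" where
  "subset_sum g r n = (\<Sum>J | J \<subseteq> {1..<n} \<and> card J = r. g J)"

lemma subset_sum_first_run:
  assumes "r < n"
  shows "subset_sum g r n = (\<Sum>a\<le>r. subset_sum (\<lambda>J. g (after_run a J)) (r - a) (n - a - 1))"
proof -
  let ?A = "\<lambda>a. {J. J \<subseteq> {1..<n - a - 1} \<and> card J = r - a}"
  let ?h = "\<lambda>(a, J). after_run a J"
  have fin: "finite J" if "J \<subseteq> {1..<m}" for J and m :: nat
    using that finite_subset by blast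
  have "?h ` (SIGMA a:{..r}. ?A a) = {J. J \<subseteq> {1..<n} \<and> card J = r}" (is "?L = ?R")
  proof (intro equalityI subsetI)
    fix J assume "J \<in> ?L"
    then obtain a K where a: "a \<le> r" "K \<subseteq> {1..<n - a - 1}" "card K = r - a" "J = after_run a K" by auto
    have "J \<subseteq> {1..<n}" using a assms by (force simp: after_run_def)
    moreover have "card J = r" using card_after_run[OF fin[OF a(2)]] a by simp
    ultimately show "J \<in> ?R" by simp
  next
    fix J assume J: "J \<in> ?R"
    then have "finite J" "0 \<notin> J" using fin by auto
    then obtain a K where K: "0 \<notin> K" "J = after_run a K" using after_run_exists by blast
    have "(\<lambda>i. i + a + 1) ` K \<subseteq> J" using K by (auto simp: after_run_def)
    then have "finite ((\<lambda>i. i + a + 1) ` K)" using \<open>finite J\<close> finite_subset by blast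
    then have "finite K" by (rule finite_imageD) (simp add: inj_on_def)
    then have card: "r = a + card K" using J card_after_run K(2) by simp
    have "K \<subseteq> {1..<n - a - 1}"
    proof
      fix i assume "i \<in> K"
      then have "i + a + 1 \<in> J" using K(2) by (auto simp: after_run_def)
      then have "i + a + 1 < n" using J by auto
      moreover have "i \<noteq> 0" using \<open>i \<in> K\<close> K(1) by metis
      ultimately show "i \<in> {1..<n - a - 1}" by simp
    qed
    then have "(a, K) \<in> (SIGMA a:{..r}. ?A a)" using card by simp
    then have "?h (a, K) \<in> ?L" by (rule imageI)
    then show "J \<in> ?L" using K(2) by simp
  qed
  then have "subset_sum g r n = sum g (?h ` (SIGMA a:{..r}. ?A a))"
    by (simp only: subset_sum_def)
  moreover have "inj_on ?h (SIGMA a:{..r}. ?A a)"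
  proof (rule inj_onI)
    fix x y assume xy: "x \<in> (SIGMA a:{..r}. ?A a)" "y \<in> (SIGMA a:{..r}. ?A a)" "?h x = ?h y"
    obtain a J b K where eq: "x = (a, J)" "y = (b, K)" by (metis surj_pair)
    have "0 \<notin> J" "0 \<notin> K" using xy(1,2) eq by auto
    moreover have "after_run a J = after_run b K" using xy(3) eq by simp
    ultimately show "x = y" using after_run_unique[of a J b K] eq by simp
  qed
  from sum.reindex[OF this] have "sum g (?h ` (SIGMA a:{..r}. ?A a)) = (\<Sum>x\<in>(SIGMA a:{..r}. ?A a). g (?h x))"
    by (simp only: comp_def)
  ultimately have "subset_sum g r n = (\<Sum>x\<in>(SIGMA a:{..r}. ?A a). g (?h x))"
    by (simp only:)
  also have "\<dots> = (\<Sum>a\<le>r. \<Sum>J\<in>?A a. g (after_run a J))"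
    by (subst sum.Sigma) (auto simp: case_prod_unfold)
  finally show ?thesis by (simp add: subset_sum_def)
qed

text \<open>
  The parameter \<open>t = n - r\<close> exceeds by one the number of elements of \<open>{1..<n}\<close> outside a set with \<open>r\<close>
  elements. Splitting off the first run and the gap after it lowers \<open>t\<close> by one. By
  invariance an empty run gives the sum for \<open>t - 1\<close> itself, so the difference in \<open>t\<close> is a combination of sums with
  smaller \<open>r\<close>.
\<close>

lemma subset_sum_binomial_combination:
  "gap_invariant g \<Longrightarrow> binomial_combination (Suc r) (\<lambda>t. subset_sum g r (r + t))"
proof (induction r arbitrary: g rule: less_induct)
  case (less r)
  let ?h = "\<lambda>t. \<Sum>a\<in>{1..r}. subset_sum (\<lambda>J. g (after_run a J)) (r - a) (r - a + t)"
  have "binomial_combination r ?h"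
  proof (rule binomial_combination_sum)
    fix a assume a: "a \<in> {1..r}"
    have "binomial_combination (Suc (r - a))
        (\<lambda>t. subset_sum (\<lambda>J. g (after_run a J)) (r - a) (r - a + t))"
      using a by (intro less.IH gap_invariant_after_run less.prems) simp
    then show "binomial_combination r
        (\<lambda>t. subset_sum (\<lambda>J. g (after_run a J)) (r - a) (r - a + t))"
      by (rule binomial_combination_mono) (use a in auto)
  qed
  moreover have "subset_sum g r (r + Suc t) = subset_sum g r (r + t) + ?h t" for t
  proof -
    have "g (after_run 0 J) = g J" if J: "J \<subseteq> {1..<r + t}" for J
    proof -
      have "finite J" "0 \<notin> J" using finite_subset[OF J] J by auto
      then have "(\<lambda>i. i + 0 + 1) ` J = shift 0 ` J"
        by (intro image_cong) (auto simp: shift_def intro!: gr0I)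
      then have "after_run 0 J = shift 0 ` J" by (simp add: after_run_def)
      then show ?thesis
        using less.prems \<open>finite J\<close> \<open>0 \<notin> J\<close> by (simp add: gap_invariant_def)
    qed
    then have zero: "subset_sum (\<lambda>J. g (after_run 0 J)) r (r + t) = subset_sum g r (r + t)"
      unfolding subset_sum_def by (intro sum.cong) auto
    have "subset_sum g r (r + Suc t)
        = (\<Sum>a\<le>r. subset_sum (\<lambda>J. g (after_run a J)) (r - a) (r + Suc t - a - 1))"
      by (rule subset_sum_first_run) simp
    also have "\<dots> = (\<Sum>a\<le>r. subset_sum (\<lambda>J. g (after_run a J)) (r - a) (r - a + t))"
      by (intro sum.cong refl arg_cong[where f = "subset_sum _ _"]) auto
    also have "{..r} = insert 0 {1..r}" by auto
    finally show ?thesis by (simp add: zero)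
  qed
  ultimately show ?case by (rule binomial_combination_summation)
qed

lemma subset_sum_polynomial:
  assumes "gap_invariant g"
  shows "\<exists>p :: rat poly. \<forall>n\<ge>r. of_int (subset_sum g r n) = poly p (of_nat n)"
proof -
  obtain p :: "rat poly" where p: "\<And>t. of_int (subset_sum g r (r + t)) = poly p (of_nat t)"
    using binomial_combination_polynomial[OF subset_sum_binomial_combination[OF assms]] by blast
  have "of_int (subset_sum g r n) = poly (pcompose p [:- of_nat r, 1:]) (of_nat n)" if "r \<le> n" for n
    using p[of "n - r"] that by (simp add: poly_pcompose of_nat_diff)
  then show ?thesis by blast
qed

theorem theorem1p2:
  fixes k :: nat
  shows "\<exists>p :: rat poly. \<forall>n::nat. n \<ge> 1 \<and> n \<ge> k \<longrightarrow>
           rat_of_int (schubert_coeff_sum k n) = poly p (rat_of_nat n)"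
proof -
  have "gap_invariant (support_sum k)"
    unfolding gap_invariant_def using support_sum_shift by blast
  then have "\<exists>p :: rat poly. \<forall>n\<ge>r. of_int (subset_sum (support_sum k) r n) = poly p (of_nat n)" for r
    by (rule subset_sum_polynomial)
  then obtain p :: "nat \<Rightarrow> rat poly" where
    p: "\<And>r n. r \<le> n \<Longrightarrow> of_int (subset_sum (support_sum k) r n) = poly (p r) (of_nat n)"
    by metis
  have "rat_of_int (schubert_coeff_sum k n) = poly (\<Sum>r\<le>k. p r) (rat_of_nat n)" if "k \<le> n" for n
  proof -
    have "schubert_coeff_sum k n
        = (\<Sum>r\<le>k. \<Sum>J | J \<in> {J. J \<subseteq> {1..<n} \<and> card J \<le> k} \<and> card J = r. support_sum k J)"
      unfolding schubert_coeff_sum_by_support by (rule sum.group[symmetric]) auto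
    also have "\<dots> = (\<Sum>r\<le>k. subset_sum (support_sum k) r n)"
      unfolding subset_sum_def by (intro sum.cong refl) auto
    finally show ?thesis using p that by (simp add: poly_sum)
  qed
  then show ?thesis by blast
qed

end
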